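(* Let $E=L^p(\Omega,\mathcal{F},\nu)$, where $(\Omega,\mathcal{F},\nu)$ is a $\sigma$-finite measure space and $1\le p\le\infty$. Suppose $T\colon E\to E$ is a bounded integral operator given by a measurable kernel $k\ge 0$ satisfying the following two assumptions: (a) some power of $T$ is compact; (b) for all $B\in\mathcal{F}$ such that $\nu(B)>0$ and $\nu(B^C)>0$ it holds that $\int_{B^C}\int_B k(x,y)\,\mathrm{d}\nu(x)\,\mathrm{d}\nu(y)>0$. Let $\lambda(T)$ be the spectral radius of $T$ and let $f$ be the unique normalized, positive eigenfunction of $T$ for the eigenvalue $\lambda(T)$ (so $\|f\|_{L^p(\nu)}=1$ and $f>0$ $\nu$-a.e.). If moreover $\mathbf{1}\in E$, the eigenfunction $f$ is bounded, and $\mu$ is a finite measure with $\mathrm{d}\mu=g\,\mathrm{d}\nu$, $g\in L^q(\Omega,\mathcal{F},\nu)$ with $\frac1p+\frac1q=1$, then $$\int_\Omega T^N(\mathbf{1})(x)\,\mathrm{d}\mu(x)=\lambda(T)^{N+o(N)}.$$ Additionally, if $p=2$ and the operator $T$ is normal, i.e. $TT^*=T^*T$, where $T^*$ denotes the adjoint operator, then $$c\,\lambda(T)^N\le\int_\Omega T^N(\mathbf{1})(x)\,\mathrm{d}\mu(x)\le C\,\lambda(T)^N$$ for some constants $c,C>0$.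
   Context: $B^C=\Omega\setminus B$, $\mathbf{1}$ is the constant function equal to $1$ on $\Omega$, $N\in\mathbb{N}$, and $o(N)$ refers to $N\to\infty$. The integral operator with kernel $k$ is $Th(x)=\int_\Omega k(x,y)h(y)\,\mathrm{d}\nu(y)$. By a Perron-Frobenius theorem for integral operators (Jentzsch; Schaefer, Banach Lattices and Positive Operators, Ch. V, Thm 6.6), under (a) and (b) the spectral radius $\lambda(T)$ is an eigenvalue of $T$ with an eigenfunction $f$ satisfying $\|f\|_{L^p(\nu)}=1$ and $f>0$ $\nu$-a.e., and any eigenfunction with these two properties coincides with $f$ $\nu$-a.e.; this is the $f$ referred to in the statement.
   Formalization: The measure μ is assumed nonzero (for μ=0 and λ(T)>0 both claims fail), and for λ(T)=1, where the literal right-hand side would be 1 (false, e.g. T(1)=1 and μ(Ω)=2), the first claim is stated as ∫T^N(1)dμ = e^{o(N)}. *)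

theory Defs
  imports "HOL-Probability.Essential_Supremum" "HOL-Library.Landau_Symbols"
begin

text \<open>
  Elements of \<open>L\<^sup>p\<close> are represented by measurable functions, and identities between elements of
  \<open>L\<^sup>p\<close> are stated almost everywhere; no quotient is formed. The exponent ranges over \<open>[1, \<infinity>]\<close>.
  Operators act on the complex space \<open>L\<^sup>p\<close>, since spectrum and spectral radius are notions for
  complex Banach spaces. A real function belongs to it through the embedding of the reals;
  \<open>Lp_space\<close>, \<open>Lp_norm\<close> and \<open>integral_op\<close> are polymorphic so that they apply to real functions
  directly.
\<close>

definition Lp_space :: "'a measure \<Rightarrow> ennreal \<Rightarrow> ('a \<Rightarrow> 'b::real_normed_vector) set" where
  "Lp_space M p = {h \<in> borel_measurable M.
     if p = \<infinity> then esssup M (\<lambda>x. ennreal (norm (h x))) < \<infinity>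
     else (\<integral>\<^sup>+ x. ennreal (norm (h x) powr enn2real p) \<partial>M) < \<infinity>}"

definition Lp_norm :: "'a measure \<Rightarrow> ennreal \<Rightarrow> ('a \<Rightarrow> 'b::real_normed_vector) \<Rightarrow> real" where
  "Lp_norm M p h =
     (if p = \<infinity> then enn2real (esssup M (\<lambda>x. ennreal (norm (h x))))
      else enn2real (\<integral>\<^sup>+ x. ennreal (norm (h x) powr enn2real p) \<partial>M) powr (1 / enn2real p))"

text \<open>
  Taking \<open>u = h\<close>, \<open>v = h'\<close>, \<open>a = 1\<close>, \<open>b = -1\<close> below shows that an operator satisfying this
  predicate maps almost everywhere equal functions to almost everywhere equal functions.
\<close>

definition bounded_operator ::
  "'a measure \<Rightarrow> ennreal \<Rightarrow> (('a \<Rightarrow> complex) \<Rightarrow> ('a \<Rightarrow> complex)) \<Rightarrow> bool" where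
  "bounded_operator M p T \<longleftrightarrow>
     (\<forall>h\<in>Lp_space M p. T h \<in> Lp_space M p) \<and>
     (\<forall>u\<in>Lp_space M p. \<forall>v\<in>Lp_space M p. \<forall>a b.
        AE x in M. T (\<lambda>y. a * u y + b * v y) x = a * T u x + b * T v x) \<and>
     (\<exists>C. \<forall>h\<in>Lp_space M p. Lp_norm M p (T h) \<le> C * Lp_norm M p h)"

definition compact_operator ::
  "'a measure \<Rightarrow> ennreal \<Rightarrow> (('a \<Rightarrow> complex) \<Rightarrow> ('a \<Rightarrow> complex)) \<Rightarrow> bool" where
  "compact_operator M p T \<longleftrightarrow> bounded_operator M p T \<and>
     (\<forall>h. (\<forall>n::nat. h n \<in> Lp_space M p \<and> Lp_norm M p (h n) \<le> 1) \<longrightarrow>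
        (\<exists>u\<in>Lp_space M p. \<exists>s. strict_mono s \<and>
           (\<lambda>n. Lp_norm M p (\<lambda>x. T (h (s n)) x - u x)) \<longlonglongrightarrow> 0))"

definition spectrum ::
  "'a measure \<Rightarrow> ennreal \<Rightarrow> (('a \<Rightarrow> complex) \<Rightarrow> ('a \<Rightarrow> complex)) \<Rightarrow> complex set" where
  "spectrum M p T = {z. \<not> (\<exists>R. bounded_operator M p R \<and>
     (\<forall>h\<in>Lp_space M p.
        (AE x in M. R (\<lambda>y. z * h y - T h y) x = h x) \<and>
        (AE x in M. z * R h x - T (R h) x = h x)))}"

definition spectral_radius ::
  "'a measure \<Rightarrow> ennreal \<Rightarrow> (('a \<Rightarrow> complex) \<Rightarrow> ('a \<Rightarrow> complex)) \<Rightarrow> real" where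
  "spectral_radius M p T = (SUP z\<in>spectrum M p T. cmod z)"

text \<open>
  \<open>is_adjoint M T S\<close> says that \<open>S\<close> is the Hilbert space adjoint of \<open>T\<close> on \<open>L\<^sup>2\<close>, which is unique
  up to almost everywhere equality.
\<close>

definition is_adjoint :: "'a measure \<Rightarrow> (('a \<Rightarrow> complex) \<Rightarrow> ('a \<Rightarrow> complex)) \<Rightarrow>
    (('a \<Rightarrow> complex) \<Rightarrow> ('a \<Rightarrow> complex)) \<Rightarrow> bool" where
  "is_adjoint M T S \<longleftrightarrow> bounded_operator M 2 S \<and>
     (\<forall>u\<in>Lp_space M 2. \<forall>v\<in>Lp_space M 2.
        (\<integral>x. T u x * cnj (v x) \<partial>M) = (\<integral>x. u x * cnj (S v x) \<partial>M))"

definition normal_operator :: "'a measure \<Rightarrow> (('a \<Rightarrow> complex) \<Rightarrow> ('a \<Rightarrow> complex)) \<Rightarrow> bool" where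
  "normal_operator M T \<longleftrightarrow> bounded_operator M 2 T \<and>
     (\<exists>S. is_adjoint M T S \<and> (\<forall>h\<in>Lp_space M 2. AE x in M. T (S h) x = S (T h) x))"

definition integral_op ::
  "'a measure \<Rightarrow> ('a \<Rightarrow> 'a \<Rightarrow> real) \<Rightarrow> ('a \<Rightarrow> 'b::{banach, second_countable_topology}) \<Rightarrow> 'a \<Rightarrow> 'b"
  where "integral_op M k h x = (\<integral>y. k x y *\<^sub>R h y \<partial>M)"

text \<open>
  The Bochner integral of a non-integrable function is \<open>0\<close>, so the convergence of the integrals
  defining the operator has to be required separately.
\<close>

definition bounded_integral_operator ::
  "'a measure \<Rightarrow> ennreal \<Rightarrow> ('a \<Rightarrow> 'a \<Rightarrow> real) \<Rightarrow> bool" where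
  "bounded_integral_operator M p k \<longleftrightarrow>
     (\<lambda>(x, y). k x y) \<in> borel_measurable (M \<Otimes>\<^sub>M M) \<and>
     (\<forall>h::'a \<Rightarrow> complex. h \<in> Lp_space M p \<longrightarrow> (AE x in M. integrable M (\<lambda>y. k x y *\<^sub>R h y))) \<and>
     bounded_operator M p (integral_op M k)"

end

theory Submission
  imports Defs "HOL-Complex_Analysis.Complex_Analysis"
begin

text \<open>
  Integrating \<open>T\<^sup>N 1 \<ge> T\<^sup>N f / \<parallel>f\<parallel>\<^sub>\<infinity> = r\<^sup>N f / \<parallel>f\<parallel>\<^sub>\<infinity>\<close> against \<open>\<mu>\<close> gives the lower bounds. For the
  upper bound in the general case, \<open>\<integral> (z - T)\<^sup>-\<^sup>1 1 d\<mu>\<close> is holomorphic for \<open>|z| > r\<close> and its Laurent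
  coefficients at infinity are the integrals in question. If \<open>p = 2\<close> and \<open>T\<close> is normal, then \<open>f\<close> is
  also an eigenfunction of the adjoint, and the Schur test with weight \<open>f\<close> yields \<open>\<parallel>T\<parallel> \<le> r\<close>.
\<close>

subsection \<open>The spaces \<open>L\<^sup>p\<close>\<close>

text \<open>The \<open>o(N)\<close> in the exponent leaves room for every rate
  \<open>\<rho> > r\<close>, so it is enough to bound the scalar sequence
  \<open>\<integral> T^N 1 d\<mu>\<close> by a multiple of \<open>\<rho>^N\<close>; one-variable
  complex analysis can then replace norm estimates of operator powers. The Neumann series only gives
  convergence for \<open>|z|\<close> above a norm bound of \<open>T\<close>. Extending the domain
  down to \<open>|z| > r\<close> is where the spectral radius enters. Operators act on
  representatives, so every identity between functions holds almost everywhere and has to be pushed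
  through the operators as such. Inverting \<open>z - T\<close> needs completeness of
  \<open>L^p\<close>. For finite \<open>p\<close> the measure is finite because \<open>1\<close>
  lies in \<open>L^p\<close>; geometric decay in \<open>L^p\<close> then gives geometric decay in
  \<open>L^1\<close>, hence pointwise limits. In the normal case the adjoint is known only through
  the inner product. Before the Schur test applies, its action on \<open>f\<close> has to be
  identified with integration against the transposed kernel.\<close>

lemma powr_convex_combination:
  fixes x y \<alpha> \<beta> P :: real
  assumes "0 \<le> x" "0 \<le> y" "0 \<le> \<alpha>" "0 \<le> \<beta>" "\<alpha> + \<beta> = 1" "1 \<le> P"
  shows "(\<alpha> * x + \<beta> * y) powr P \<le> \<alpha> * x powr P + \<beta> * y powr P"
proof -
  have le: "t powr P \<le> t" if "0 \<le> t" "t \<le> 1" for t :: real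
    using powr_mono'[of 1 P t] that \<open>1 \<le> P\<close> by auto
  \<comment> \<open>If one point is 0, the claim reduces to
    \<open>\<beta> powr P \<le> \<beta>\<close> (or the same for \<open>\<alpha>\<close>) on [0,1];
    convexity on the open half-line settles the rest.\<close>
  consider "x = 0" | "y = 0" | "0 < x" "0 < y" using assms by force
  then show ?thesis
  proof cases
    case 1
    then show ?thesis using le[of \<beta>] assms
      by (auto simp: powr_mult intro!: mult_right_mono)
  next
    case 2
    then show ?thesis using le[of \<alpha>] assms
      by (auto simp: powr_mult intro!: mult_right_mono)
  next
    case 3
    have "\<alpha> = 1 - \<beta>" using assms by simp
    show ?thesis
      using convex_onD[OF powr_convex[OF \<open>1 \<le> P\<close>], of \<beta> x y] assms(1-4,6) 3 
      by (simp add: \<open>\<alpha> = 1 - \<beta>\<close>)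
  qed
qed

lemma enn2real_ge_1: "1 \<le> p \<Longrightarrow> p \<noteq> \<infinity> \<Longrightarrow> 1 \<le> enn2real p"
  using enn2real_mono[of 1 p] by (simp add: less_top)

lemma Lp_space_measurable: "h \<in> Lp_space M p \<Longrightarrow> h \<in> borel_measurable M"
  by (simp add: Lp_space_def)

lemma Lp_norm_nonneg: "0 \<le> Lp_norm M p h"
  by (simp add: Lp_norm_def)

text \<open>
  The unit ball is described without taking a \<open>p\<close>-th root; all properties of the norm are read off
  from this description.
\<close>

lemma Lp_norm_le_iff:
  fixes h :: "'a \<Rightarrow> 'b::real_normed_vector"
  assumes p: "1 \<le> p" and h: "h \<in> borel_measurable M" and c: "0 < c"
  shows "h \<in> Lp_space M p \<and> Lp_norm M p h \<le> c \<longleftrightarrow>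
    (if p = \<infinity> then AE x in M. norm (h x) \<le> c
     else (\<integral>\<^sup>+ x. ennreal ((norm (h x) / c) powr enn2real p) \<partial>M) \<le> 1)"
proof (cases "p = \<infinity>")
  case True
  let ?s = "esssup M (\<lambda>x. ennreal (norm (h x)))"
  \<comment> \<open>Finiteness has to be carried along on the left, because \<open>enn2real\<close>
    sends \<infinity> to 0.\<close>
  have "?s < \<infinity> \<and> enn2real ?s \<le> c \<longleftrightarrow> ?s \<le> ennreal c"
    using c by (cases ?s) (auto simp: ennreal_le_iff top_unique)
  also have "\<dots> \<longleftrightarrow> (AE x in M. norm (h x) \<le> c)"
  proof
    assume "?s \<le> ennreal c"
    then have "AE x in M. ennreal (norm (h x)) \<le> ennreal c"
      using esssup_AE[of "\<lambda>x. ennreal (norm (h x))" M] by (auto elim!: eventually_mono)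
    then show "AE x in M. norm (h x) \<le> c" using c by (simp add: ennreal_le_iff)
  next
    assume "AE x in M. norm (h x) \<le> c"
    then show "?s \<le> ennreal c"
      using h by (intro esssup_I) (auto intro: ennreal_leI)
  qed
  finally show ?thesis using True h by (simp add: Lp_space_def Lp_norm_def)
next
  case False
  let ?P = "enn2real p"
  let ?I = "\<integral>\<^sup>+ x. ennreal (norm (h x) powr ?P) \<partial>M"
  have P: "1 \<le> ?P" using p False by (rule enn2real_ge_1)
  have pos: "0 < c powr ?P" using c by simp
  have "(\<integral>\<^sup>+ x. ennreal ((norm (h x) / c) powr ?P) \<partial>M)
      = (\<integral>\<^sup>+ x. ennreal (norm (h x) powr ?P) * ennreal (1 / c powr ?P) \<partial>M)"
    using c by (intro nn_integral_cong) (auto simp: ennreal_mult[symmetric] powr_divide)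
  also have "\<dots> = ?I * ennreal (1 / c powr ?P)"
    using h by (intro nn_integral_multc) auto
  finally have eq: "(\<integral>\<^sup>+ x. ennreal ((norm (h x) / c) powr ?P) \<partial>M) = ?I * ennreal (1 / c powr ?P)" .
  have "?I < \<infinity> \<and> enn2real ?I powr (1 / ?P) \<le> c \<longleftrightarrow> ?I * ennreal (1 / c powr ?P) \<le> 1"
  proof (cases ?I)
    case (real i)
    have "i powr (1 / ?P) \<le> c \<longleftrightarrow> i \<le> c powr ?P"
    proof
      assume "i powr (1 / ?P) \<le> c"
      then have "(i powr (1 / ?P)) powr ?P \<le> c powr ?P"
        using P by (intro powr_mono2) auto
      then show "i \<le> c powr ?P" using P real by (simp add: powr_powr)
    next
      assume "i \<le> c powr ?P"
      then have "i powr (1 / ?P) \<le> (c powr ?P) powr (1 / ?P)"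
        using P real by (intro powr_mono2) auto
      then show "i powr (1 / ?P) \<le> c" using P c by (simp add: powr_powr)
    qed
    also have "\<dots> \<longleftrightarrow> i * (1 / c powr ?P) \<le> 1" using pos by (simp add: field_simps)
    also have "\<dots> \<longleftrightarrow> ennreal i * ennreal (1 / c powr ?P) \<le> 1"
      using real by (simp add: ennreal_mult[symmetric] del: ennreal_1 add: ennreal_1[symmetric] ennreal_le_iff)
    finally show ?thesis using real by simp
  next
    case top
    then show ?thesis using pos by (simp add: ennreal_top_mult top_unique)
  qed
  then show ?thesis using False h eq by (simp add: Lp_space_def Lp_norm_def)
qed

text \<open>Minkowski's inequality from convexity of the unit ball: (u + v) / (a + b) is the convex
  combination of u / a and v / b with weights a / (a + b) and b / (a + b). The radii a and b must be
  positive although the norms may vanish, hence the slack \<epsilon>.\<close>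

lemma Lp_space_add:
  fixes u v :: "'a \<Rightarrow> 'b::{real_normed_vector, second_countable_topology}"
  assumes p: "1 \<le> p" and u: "u \<in> Lp_space M p" and v: "v \<in> Lp_space M p"
  shows "(\<lambda>x. u x + v x) \<in> Lp_space M p"
    and Lp_norm_triangle: "Lp_norm M p (\<lambda>x. u x + v x) \<le> Lp_norm M p u + Lp_norm M p v"
proof -
  have [measurable]: "u \<in> borel_measurable M" "v \<in> borel_measurable M"
    using u v by (auto intro: Lp_space_measurable)
  have *: "(\<lambda>x. u x + v x) \<in> Lp_space M p \<and>
      Lp_norm M p (\<lambda>x. u x + v x) \<le> Lp_norm M p u + Lp_norm M p v + \<epsilon>" if "0 < \<epsilon>" for \<epsilon>
  proof -
    define a where "a = Lp_norm M p u + \<epsilon> / 2"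
    define b where "b = Lp_norm M p v + \<epsilon> / 2"
    have ab: "0 < a" "0 < b" using that Lp_norm_nonneg[of M p u] Lp_norm_nonneg[of M p v]
      by (auto simp: a_def b_def)
    have ua: "u \<in> Lp_space M p \<and> Lp_norm M p u \<le> a" and vb: "v \<in> Lp_space M p \<and> Lp_norm M p v \<le> b"
      using u v that by (auto simp: a_def b_def)
    have "(\<lambda>x. u x + v x) \<in> Lp_space M p \<and> Lp_norm M p (\<lambda>x. u x + v x) \<le> a + b"
    proof (cases "p = \<infinity>")
      case True
      have "AE x in M. norm (u x) \<le> a" "AE x in M. norm (v x) \<le> b"
        using ua vb Lp_norm_le_iff[of p u M a] Lp_norm_le_iff[of p v M b] p ab True by auto
      then have "AE x in M. norm (u x + v x) \<le> a + b"
        by eventually_elim (rule norm_triangle_mono)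
      then show ?thesis
        using Lp_norm_le_iff[of p "\<lambda>x. u x + v x" M "a + b"] p ab True by auto
    next
      case False
      let ?P = "enn2real p"
      have P: "1 \<le> ?P" using p False by (rule enn2real_ge_1)
      have I: "(\<integral>\<^sup>+ x. ennreal ((norm (u x) / a) powr ?P) \<partial>M) \<le> 1"
         "(\<integral>\<^sup>+ x. ennreal ((norm (v x) / b) powr ?P) \<partial>M) \<le> 1"
        using ua vb Lp_norm_le_iff[of p u M a] Lp_norm_le_iff[of p v M b] p ab False by auto
      have pt: "(norm (u x + v x) / (a + b)) powr ?P \<le>
          a / (a + b) * (norm (u x) / a) powr ?P + b / (a + b) * (norm (v x) / b) powr ?P" for x
      proof -
        have "norm (u x + v x) / (a + b) \<le> a / (a + b) * (norm (u x) / a) + b / (a + b) * (norm (v x) / b)"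
          using ab norm_triangle_ineq[of "u x" "v x"]
          by (simp add: divide_right_mono add_divide_distrib[symmetric])
        then have "(norm (u x + v x) / (a + b)) powr ?P \<le>
            (a / (a + b) * (norm (u x) / a) + b / (a + b) * (norm (v x) / b)) powr ?P"
          using P ab by (intro powr_mono2) auto
        also have "\<dots> \<le> a / (a + b) * (norm (u x) / a) powr ?P + b / (a + b) * (norm (v x) / b) powr ?P"
          using P ab by (intro powr_convex_combination) (auto simp: add_divide_distrib[symmetric])
        finally show ?thesis .
      qed
      have "(\<integral>\<^sup>+ x. ennreal ((norm (u x + v x) / (a + b)) powr ?P) \<partial>M) \<le>
        (\<integral>\<^sup>+ x. ennreal (a / (a + b)) * ennreal ((norm (u x) / a) powr ?P)
           + ennreal (b / (a + b)) * ennreal ((norm (v x) / b) powr ?P) \<partial>M)"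
        using pt ab by (intro nn_integral_mono)
          (auto simp: ennreal_mult[symmetric] ennreal_plus[symmetric] simp del: ennreal_plus intro!: ennreal_leI)
      also have "\<dots> = ennreal (a / (a + b)) * (\<integral>\<^sup>+ x. ennreal ((norm (u x) / a) powr ?P) \<partial>M)
           + ennreal (b / (a + b)) * (\<integral>\<^sup>+ x. ennreal ((norm (v x) / b) powr ?P) \<partial>M)"
        by (simp add: nn_integral_add nn_integral_cmult)
      also have "\<dots> \<le> ennreal (a / (a + b)) * 1 + ennreal (b / (a + b)) * 1"
        using I by (intro add_mono mult_left_mono) auto
      also have "\<dots> = 1"
        using ab by (simp add: ennreal_plus[symmetric] add_divide_distrib[symmetric] del: ennreal_plus)
      finally show ?thesis
        using Lp_norm_le_iff[of p "\<lambda>x. u x + v x" M "a + b"] p ab False by auto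
    qed
    then show ?thesis by (simp add: a_def b_def algebra_simps)
  qed
  show "(\<lambda>x. u x + v x) \<in> Lp_space M p" using *[of 1] by simp
  show "Lp_norm M p (\<lambda>x. u x + v x) \<le> Lp_norm M p u + Lp_norm M p v"
    using * by - (rule field_le_epsilon, auto)
qed

lemma Lp_norm_zero:
  fixes h :: "'a \<Rightarrow> 'b::real_normed_vector"
  assumes p: "1 \<le> p" and h: "h \<in> borel_measurable M" and z: "AE x in M. h x = 0"
  shows "h \<in> Lp_space M p" "Lp_norm M p h = 0"
proof -
  have *: "h \<in> Lp_space M p \<and> Lp_norm M p h \<le> \<epsilon>" if "0 < \<epsilon>" for \<epsilon>
  proof -
    have "AE x in M. norm (h x) \<le> \<epsilon>" using z that by (auto elim!: eventually_mono)
    moreover have "(\<integral>\<^sup>+ x. ennreal ((norm (h x) / \<epsilon>) powr enn2real p) \<partial>M) = (\<integral>\<^sup>+ x. 0 \<partial>M)"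
      using z by (intro nn_integral_cong_AE) (auto elim!: eventually_mono)
    ultimately show ?thesis using Lp_norm_le_iff[OF p h that] by (auto split: if_splits)
  qed
  show "h \<in> Lp_space M p" using *[of 1] by simp
  have "Lp_norm M p h \<le> 0" using * by - (rule field_le_epsilon, auto)
  then show "Lp_norm M p h = 0" using Lp_norm_nonneg[of M p h] by simp
qed

lemma Lp_norm_zeroD:
  fixes h :: "'a \<Rightarrow> 'b::real_normed_vector"
  assumes p: "1 \<le> p" and h: "h \<in> Lp_space M p" and z: "Lp_norm M p h \<le> 0"
  shows "AE x in M. h x = 0"
proof (cases "p = \<infinity>")
  case True
  have "AE x in M. norm (h x) \<le> 1 / real (Suc n)" for n
  proof -
    have "Lp_norm M p h \<le> 1 / real (Suc n)" using z by (rule order_trans) simp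
    then show ?thesis
      using Lp_norm_le_iff[OF p, of h M "1 / real (Suc n)"] h True by (simp add: Lp_space_measurable)
  qed
  then have "AE x in M. \<forall>n. norm (h x) \<le> 1 / real (Suc n)" by (simp add: AE_all_countable)
  then show ?thesis
  proof eventually_elim
    case (elim x)
    show ?case
    proof (rule ccontr)
      assume "h x \<noteq> 0"
      then obtain n where "1 / real (Suc n) < norm (h x)"
        using reals_Archimedean[of "norm (h x)"] by (auto simp: inverse_eq_divide)
      then show False using elim[rule_format, of n] by simp
    qed
  qed
next
  case False
  have [measurable]: "h \<in> borel_measurable M" using h by (rule Lp_space_measurable)
  let ?I = "\<integral>\<^sup>+ x. ennreal (norm (h x) powr enn2real p) \<partial>M"
  have P: "1 \<le> enn2real p" using p False by (rule enn2real_ge_1)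
  have fin: "?I < \<infinity>" using h False by (simp add: Lp_space_def)
  have "enn2real ?I powr (1 / enn2real p) = 0"
    using z False Lp_norm_nonneg[of M p h] by (simp add: Lp_norm_def)
  then have "?I = 0" using fin by (cases ?I) auto
  then have "AE x in M. ennreal (norm (h x) powr enn2real p) = 0"
    by (subst (asm) nn_integral_0_iff_AE) auto
  then show ?thesis by eventually_elim (auto simp: ennreal_eq_0_iff)
qed

lemma Lp_space_cmult:
  fixes h :: "'a \<Rightarrow> 'b::{real_normed_field, second_countable_topology}"
  assumes p: "1 \<le> p" and h: "h \<in> Lp_space M p"
  shows "(\<lambda>x. a * h x) \<in> Lp_space M p"
    and Lp_norm_cmult_le: "Lp_norm M p (\<lambda>x. a * h x) \<le> norm a * Lp_norm M p h"
proof -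
  have hm[measurable]: "h \<in> borel_measurable M" using h by (rule Lp_space_measurable)
  have "(\<lambda>x. a * h x) \<in> Lp_space M p \<and> Lp_norm M p (\<lambda>x. a * h x) \<le> norm a * Lp_norm M p h"
  proof (cases "a = 0")
    case True
    then show ?thesis using Lp_norm_zero[OF p, of "\<lambda>_. 0 :: 'b" M] by simp
  next
    case False
    have *: "(\<lambda>x. a * h x) \<in> Lp_space M p \<and> Lp_norm M p (\<lambda>x. a * h x) \<le> norm a * Lp_norm M p h + \<epsilon>"
      if "0 < \<epsilon>" for \<epsilon>
    proof -
      \<comment> \<open>The slack is divided by \<open>norm a\<close>, so that scaling by
        \<open>a\<close> turns it into exactly \<epsilon>.\<close>
      define c where "c = Lp_norm M p h + \<epsilon> / norm a"
      have c: "0 < c" using False that Lp_norm_nonneg[of M p h] by (auto simp: c_def intro: add_nonneg_pos)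
      have le: "Lp_norm M p h \<le> c" using False that by (auto simp: c_def)
      have "(norm (a * h x) / (norm a * c)) = norm (h x) / c" for x using False by (simp add: norm_mult)
      then have "(\<lambda>x. a * h x) \<in> Lp_space M p \<and> Lp_norm M p (\<lambda>x. a * h x) \<le> norm a * c"
        using Lp_norm_le_iff[OF p hm c] Lp_norm_le_iff[OF p, of "\<lambda>x. a * h x" M "norm a * c"] h le c False
        by (auto simp: norm_mult split: if_splits)
      then show ?thesis using False by (simp add: c_def distrib_left)
    qed
    have "Lp_norm M p (\<lambda>x. a * h x) \<le> norm a * Lp_norm M p h"
      using * by - (rule field_le_epsilon, auto)
    then show ?thesis using *[of 1] by simp
  qed
  then show "(\<lambda>x. a * h x) \<in> Lp_space M p" "Lp_norm M p (\<lambda>x. a * h x) \<le> norm a * Lp_norm M p h" by auto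
qed

lemma Lp_space_lincomb:
  fixes u v :: "'a \<Rightarrow> 'b::{real_normed_field, second_countable_topology}"
  assumes "1 \<le> p" "u \<in> Lp_space M p" "v \<in> Lp_space M p"
  shows "(\<lambda>x. a * u x + b * v x) \<in> Lp_space M p"
  using assms by (intro Lp_space_add Lp_space_cmult)

lemma Lp_space_diff:
  fixes u v :: "'a \<Rightarrow> 'b::{real_normed_field, second_countable_topology}"
  assumes "1 \<le> p" "u \<in> Lp_space M p" "v \<in> Lp_space M p"
  shows "(\<lambda>x. u x - v x) \<in> Lp_space M p"
  using Lp_space_lincomb[OF assms, of 1 "-1"] by simp

lemma Lp_space_cong_AE:
  fixes u v :: "'a \<Rightarrow> 'b::real_normed_vector"
  assumes u: "u \<in> borel_measurable M" and v: "v \<in> Lp_space M p" and eq: "AE x in M. u x = v x"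
  shows "u \<in> Lp_space M p" and Lp_norm_cong_AE: "Lp_norm M p u = Lp_norm M p v"
proof -
  have "(\<integral>\<^sup>+ x. ennreal (norm (u x) powr enn2real p) \<partial>M) = (\<integral>\<^sup>+ x. ennreal (norm (v x) powr enn2real p) \<partial>M)"
    using eq by (intro nn_integral_cong_AE) (auto elim!: eventually_mono)
  moreover have "esssup M (\<lambda>x. ennreal (norm (u x))) = esssup M (\<lambda>x. ennreal (norm (v x)))"
    using eq u Lp_space_measurable[OF v] by (intro esssup_AE_cong) (auto elim!: eventually_mono)
  ultimately show "u \<in> Lp_space M p" "Lp_norm M p u = Lp_norm M p v"
    using u v by (simp_all add: Lp_space_def Lp_norm_def split: if_splits)
qed

lemma Lp_norm_diff_le:
  fixes u v :: "'a \<Rightarrow> 'b::{real_normed_field, second_countable_topology}"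
  assumes p: "1 \<le> p" and u: "u \<in> Lp_space M p" and v: "v \<in> Lp_space M p"
  shows "Lp_norm M p (\<lambda>x. u x - v x) \<le> Lp_norm M p u + Lp_norm M p v"
  using Lp_norm_triangle[OF p u Lp_space_cmult(1)[OF p v, of "-1"]] Lp_norm_cmult_le[OF p v, of "-1"] by simp

section \<open>Almost everywhere limits and completeness\<close>

text \<open>For finite p this is Fatou's lemma for the normalised integrand; for p = \<infinity> the
  pointwise bound passes to the limit. The threshold \<open>n0\<close> allows differences u m - u n
  with n fixed, which are controlled only for m \<ge> n.\<close>

lemma Lp_fatou:
  fixes u :: "nat \<Rightarrow> 'a \<Rightarrow> 'b::{real_normed_vector, second_countable_topology}"
  assumes p: "1 \<le> p" and u: "\<And>n. u n \<in> Lp_space M p" and le: "\<And>n. n \<ge> n0 \<Longrightarrow> Lp_norm M p (u n) \<le> c"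
    and h: "h \<in> borel_measurable M" and lim: "AE x in M. (\<lambda>n. u n x) \<longlonglongrightarrow> h x"
  shows "h \<in> Lp_space M p" "Lp_norm M p h \<le> c"
proof -
  have [measurable]: "u n \<in> borel_measurable M" for n using u by (rule Lp_space_measurable)
  note h[measurable]
  have c: "0 \<le> c" using le[of n0] Lp_norm_nonneg[of M p "u n0"] by simp
  have *: "h \<in> Lp_space M p \<and> Lp_norm M p h \<le> c + \<epsilon>" if "0 < \<epsilon>" for \<epsilon>
  proof -
    define d where "d = c + \<epsilon>"
    have d: "0 < d" using c that by (simp add: d_def)
    have ud: "n \<ge> n0 \<Longrightarrow> u n \<in> Lp_space M p \<and> Lp_norm M p (u n) \<le> d" for n
      using u le[of n] that by (simp add: d_def)
    show ?thesis
    proof (cases "p = \<infinity>")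
      case True
      have "AE x in M. \<forall>n\<ge>n0. norm (u n x) \<le> d"
        using ud Lp_norm_le_iff[OF p _ d, of "u _" M] True by (auto simp: AE_all_countable)
      then have "AE x in M. norm (h x) \<le> d"
        using lim
      proof eventually_elim
        case (elim x)
        have "(\<lambda>n. norm (u n x)) \<longlonglongrightarrow> norm (h x)" using elim(2) by (rule tendsto_norm)
        then show ?case using elim(1) by (rule LIMSEQ_le_const2[OF _ exI[of _ n0]]) 
      qed
      then show ?thesis using Lp_norm_le_iff[OF p h d] True by (auto simp: d_def)
    next
      case False
      let ?P = "enn2real p"
      have P: "1 \<le> ?P" using p False by (rule enn2real_ge_1)
      have I: "n \<ge> n0 \<Longrightarrow> (\<integral>\<^sup>+ x. ennreal ((norm (u n x) / d) powr ?P) \<partial>M) \<le> 1" for n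
        using ud[of n] Lp_norm_le_iff[OF p _ d, of "u n" M] False by auto
      have "(\<integral>\<^sup>+ x. ennreal ((norm (h x) / d) powr ?P) \<partial>M)
          = (\<integral>\<^sup>+ x. liminf (\<lambda>n. ennreal ((norm (u n x) / d) powr ?P)) \<partial>M)"
      proof (rule nn_integral_cong_AE, use lim in eventually_elim)
        case (elim x)
        have "(\<lambda>n. ennreal ((norm (u n x) / d) powr ?P)) \<longlonglongrightarrow> ennreal ((norm (h x) / d) powr ?P)"
          using elim P d by (intro tendsto_intros tendsto_ennrealI tendsto_powr') auto
        then show ?case by (intro lim_imp_Liminf[symmetric]) auto
      qed
      also have "\<dots> \<le> liminf (\<lambda>n. \<integral>\<^sup>+ x. ennreal ((norm (u n x) / d) powr ?P) \<partial>M)"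
        by (intro nn_integral_liminf) auto
      also have "\<dots> \<le> 1"
        using Liminf_le[of sequentially "\<lambda>n. \<integral>\<^sup>+ x. ennreal ((norm (u n x) / d) powr ?P) \<partial>M" 1] I
        by (auto simp: eventually_sequentially)
      finally show ?thesis using Lp_norm_le_iff[OF p h d] False by (auto simp: d_def)
    qed
  qed
  show "h \<in> Lp_space M p" using *[of 1] by simp
  show "Lp_norm M p h \<le> c" using * by - (rule field_le_epsilon, auto)
qed

text \<open>Rests on t \<le> 1 + t^P for t \<ge> 0 and P \<ge> 1. On a finite measure space this
  embeds \<open>L^p\<close> into \<open>L^1\<close>; the constant is crude, but it is linear in
  \<open>c\<close>, which is what summability requires.\<close>

lemma Lp_nn_integral_norm_le:
  fixes h :: "'a \<Rightarrow> 'b::{real_normed_vector, second_countable_topology}"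
  assumes p: "1 \<le> p" "p \<noteq> \<infinity>" and h: "h \<in> Lp_space M p" and c: "0 < c" "Lp_norm M p h \<le> c"
  shows "(\<integral>\<^sup>+ x. ennreal (norm (h x)) \<partial>M) \<le> ennreal c * (emeasure M (space M) + 1)"
proof -
  have hm[measurable]: "h \<in> borel_measurable M" using h by (rule Lp_space_measurable)
  let ?P = "enn2real p"
  have P: "1 \<le> ?P" using p by (rule enn2real_ge_1)
  have I: "(\<integral>\<^sup>+ x. ennreal ((norm (h x) / c) powr ?P) \<partial>M) \<le> 1"
    using Lp_norm_le_iff[OF p(1) hm c(1)] h c p by auto
  have pt: "norm (h x) \<le> c * (1 + (norm (h x) / c) powr ?P)" for x
  proof -
    have "norm (h x) / c \<le> 1 + (norm (h x) / c) powr ?P"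
    proof (cases "norm (h x) / c \<le> 1")
      case False
      then have "norm (h x) / c \<le> (norm (h x) / c) powr ?P"
        using powr_mono[of 1 ?P "norm (h x) / c"] P c by simp
      then show ?thesis by simp
    qed (simp add: add_increasing2)
    then show ?thesis using c by (simp add: field_simps)
  qed
  have "(\<integral>\<^sup>+ x. ennreal (norm (h x)) \<partial>M) \<le> (\<integral>\<^sup>+ x. ennreal c * (1 + ennreal ((norm (h x) / c) powr ?P)) \<partial>M)"
    using c by (intro nn_integral_mono ennreal_leI[OF pt, THEN order_trans]) (auto simp: ennreal_mult)
  also have "\<dots> = ennreal c * (emeasure M (space M) + (\<integral>\<^sup>+ x. ennreal ((norm (h x) / c) powr ?P) \<partial>M))"
    by (simp add: nn_integral_cmult nn_integral_add)
  also have "\<dots> \<le> ennreal c * (emeasure M (space M) + 1)"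
    using I by (intro mult_left_mono add_left_mono) auto
  finally show ?thesis .
qed

text \<open>On a finite measure space the \<open>L^1\<close> norms decay geometrically too, so the
  sum of the norms has a finite integral and is finite almost everywhere. For p = \<infinity> the
  series is dominated pointwise by the geometric one.\<close>

lemma Lp_AE_summable:
  fixes d :: "nat \<Rightarrow> 'a \<Rightarrow> 'b::{real_normed_vector, second_countable_topology}"
  assumes p: "1 \<le> p" and fin: "p \<noteq> \<infinity> \<Longrightarrow> finite_measure M"
    and d: "\<And>n. d n \<in> Lp_space M p" and le: "\<And>n. Lp_norm M p (d n) \<le> K * \<theta> ^ n"
    and K: "0 < K" and \<theta>: "0 < \<theta>" "\<theta> < 1"
  shows "AE x in M. summable (\<lambda>n. norm (d n x))"
proof (cases "p = \<infinity>")
  case True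
  have "AE x in M. \<forall>n. norm (d n x) \<le> K * \<theta> ^ n"
    unfolding AE_all_countable
  proof
    show "AE x in M. norm (d n x) \<le> K * \<theta> ^ n" for n
      using d[of n] le[of n] Lp_norm_le_iff[OF p, of "d n" M "K * \<theta> ^ n"] K \<theta> True
      by (auto simp: Lp_space_measurable)
  qed
  then show ?thesis
  proof eventually_elim
    case (elim x)
    have "summable (\<lambda>n. K * \<theta> ^ n)" using \<theta> by (intro summable_mult summable_geometric) auto
    then show ?case by (rule summable_comparison_test'[where N=0]) (use elim in auto)
  qed
next
  case False
  then interpret finite_measure M by (rule fin)
  have [measurable]: "d n \<in> borel_measurable M" for n using d by (rule Lp_space_measurable)
  define m where "m = measure M (space M) + 1"
  have m: "emeasure M (space M) + 1 = ennreal m" "0 \<le> m"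
    by (auto simp: m_def emeasure_eq_measure)
  have "(\<integral>\<^sup>+ x. (\<Sum>n. ennreal (norm (d n x))) \<partial>M) = (\<Sum>n. \<integral>\<^sup>+ x. ennreal (norm (d n x)) \<partial>M)"
    by (intro nn_integral_suminf) auto
  also have "\<dots> \<le> (\<Sum>n. ennreal (K * \<theta> ^ n * m))"
  proof (intro suminf_le)
    show "(\<integral>\<^sup>+ x. ennreal (norm (d n x)) \<partial>M) \<le> ennreal (K * \<theta> ^ n * m)" for n
      using Lp_nn_integral_norm_le[OF p False d[of n] _ le[of n]] K \<theta> m
      by (simp add: ennreal_mult)
  qed auto
  also have "\<dots> < \<infinity>"
    using K \<theta> m by (subst suminf_ennreal2) (auto intro!: summable_mult summable_mult2 summable_geometric)
  finally have "(\<integral>\<^sup>+ x. (\<Sum>n. ennreal (norm (d n x))) \<partial>M) \<noteq> \<infinity>" by simp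
  then have "AE x in M. (\<Sum>n. ennreal (norm (d n x))) \<noteq> \<infinity>"
    by (intro nn_integral_PInf_AE) auto
  then show ?thesis
    by eventually_elim (intro summable_suminf_not_top, auto)
qed

text \<open>The Riesz-Fischer theorem in the form that a contraction needs: the telescoping series
  converges almost everywhere, and Fatou transfers the tail estimate to the limit.\<close>

lemma Lp_geometric_Cauchy_converges:
  fixes u :: "nat \<Rightarrow> 'a \<Rightarrow> 'b::{real_normed_field, banach, second_countable_topology}"
  assumes p: "1 \<le> p" and fin: "p \<noteq> \<infinity> \<Longrightarrow> finite_measure M"
    and u: "\<And>n. u n \<in> Lp_space M p"
    and le: "\<And>n. Lp_norm M p (\<lambda>x. u (Suc n) x - u n x) \<le> K * \<theta> ^ n"
    and K: "0 < K" and \<theta>: "0 < \<theta>" "\<theta> < 1"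
  obtains h where "h \<in> Lp_space M p" "\<And>n. Lp_norm M p (\<lambda>x. h x - u n x) \<le> K * \<theta> ^ n / (1 - \<theta>)"
proof -
  have [measurable]: "u n \<in> borel_measurable M" for n using u by (rule Lp_space_measurable)
  \<comment> \<open>\<open>lim\<close> has an unspecified value at points of divergence; they form a
    null set, and the function is still measurable.\<close>
  define h where "h x = lim (\<lambda>n. u n x)" for x
  have [measurable]: "h \<in> borel_measurable M" unfolding h_def by measurable
  have dLp: "(\<lambda>x. u m x - u n x) \<in> Lp_space M p" for m n using p u u by (rule Lp_space_diff)
  have "AE x in M. summable (\<lambda>n. norm (u (Suc n) x - u n x))"
    using Lp_AE_summable[OF p fin dLp le K \<theta>] .
  then have conv: "AE x in M. (\<lambda>n. u n x) \<longlonglongrightarrow> h x"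
  proof eventually_elim
    case (elim x)
    then have "summable (\<lambda>n. u (Suc n) x - u n x)" by (rule summable_norm_cancel)
    then have "convergent (\<lambda>n. \<Sum>i<n. u (Suc i) x - u i x)" by (simp add: summable_iff_convergent)
    then have "convergent (\<lambda>n. u n x - u 0 x)"
      using sum_lessThan_telescope[of "\<lambda>n. u n x"] by simp
    then have "convergent (\<lambda>n. u n x)" using convergent_diff_const_right_iff by blast
    then show ?case unfolding h_def by (simp add: convergent_LIMSEQ_iff)
  qed
  \<comment> \<open>The exact geometric partial sum is kept so that the induction closes; the factor
    1 - \<theta>^j is discarded afterwards.\<close>
  have tail: "Lp_norm M p (\<lambda>x. u (n + j) x - u n x) \<le> K * \<theta> ^ n * (1 - \<theta> ^ j) / (1 - \<theta>)" for n j
  proof (induction j)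
    case 0
    then show ?case using Lp_norm_zero[OF p, of "\<lambda>_. 0 :: 'b" M] by simp
  next
    case (Suc j)
    have "Lp_norm M p (\<lambda>x. u (n + Suc j) x - u n x)
        \<le> Lp_norm M p (\<lambda>x. u (Suc (n + j)) x - u (n + j) x) + Lp_norm M p (\<lambda>x. u (n + j) x - u n x)"
      using Lp_norm_triangle[OF p dLp dLp, of "Suc (n + j)" "n + j" "n + j" n] by simp
    also have "\<dots> \<le> K * \<theta> ^ (n + j) + K * \<theta> ^ n * (1 - \<theta> ^ j) / (1 - \<theta>)"
      using le Suc by (intro add_mono) auto
    also have "\<dots> = K * \<theta> ^ n * (1 - \<theta> ^ Suc j) / (1 - \<theta>)"
      using \<theta> by (simp add: field_simps power_add)
    finally show ?case .
  qed
  have main: "(\<lambda>x. h x - u n x) \<in> Lp_space M p" "Lp_norm M p (\<lambda>x. h x - u n x) \<le> K * \<theta> ^ n / (1 - \<theta>)" for n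
  proof -
    have le': "Lp_norm M p (\<lambda>x. u m x - u n x) \<le> K * \<theta> ^ n / (1 - \<theta>)" if "m \<ge> n" for m
    proof -
      have "K * \<theta> ^ n * (1 - \<theta> ^ (m - n)) / (1 - \<theta>) \<le> K * \<theta> ^ n * 1 / (1 - \<theta>)"
        using K \<theta> by (intro divide_right_mono mult_left_mono) auto
      then show ?thesis using tail[of n "m - n"] that by simp
    qed
    have lim: "AE x in M. (\<lambda>m. u m x - u n x) \<longlonglongrightarrow> h x - u n x"
      using conv by eventually_elim (auto intro: tendsto_intros)
    show "(\<lambda>x. h x - u n x) \<in> Lp_space M p" "Lp_norm M p (\<lambda>x. h x - u n x) \<le> K * \<theta> ^ n / (1 - \<theta>)"
      using Lp_fatou[OF p dLp le' _ lim] by auto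
  qed
  have "h \<in> Lp_space M p"
    using Lp_space_add[OF p main(1)[of 0] u[of 0]] by simp
  then show thesis using main that by blast
qed

section \<open>Hoelder's inequality for conjugate exponents\<close>

lemma ennreal_one_divide_eq_1D:
  fixes x :: ennreal
  assumes "1 / x = 1"
  shows "x = 1"
proof (cases x)
  case (real y)
  have "y \<noteq> 0" using assms real by (auto simp: ennreal_divide_zero)
  then have "1 / x = ennreal (1 / y)" using real divide_ennreal[of 1 y] by simp
  with assms have "ennreal (1 / y) = ennreal 1" by simp
  then show ?thesis using real \<open>y \<noteq> 0\<close> by (subst (asm) ennreal_inj) auto
qed (use assms in auto)

text \<open>For exponents strictly between 1 and \<infinity>, Young's inequality is applied to g and
  h / c pointwise. This gives the constant 1 + \<integral>|g|^q instead of the sharp norm of g; what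
  matters is only that it does not depend on h, i.e. that integration against g is a bounded
  functional.\<close>

lemma Lp_Hoelder:
  fixes g :: "'a \<Rightarrow> real"
  assumes p: "1 \<le> p" and q: "1 / p + 1 / q = 1" and g: "g \<in> Lp_space M q"
  obtains K where "0 \<le> K"
    and "\<And>h :: 'a \<Rightarrow> 'b::{banach, second_countable_topology}. h \<in> Lp_space M p \<Longrightarrow>
      integrable M (\<lambda>x. g x *\<^sub>R h x) \<and> norm (\<integral>x. g x *\<^sub>R h x \<partial>M) \<le> K * Lp_norm M p h"
proof -
  have gm[measurable]: "g \<in> borel_measurable M" using g by (rule Lp_space_measurable)
  have "\<exists>K\<ge>0. \<forall>h :: 'a \<Rightarrow> 'b. \<forall>c>0. h \<in> Lp_space M p \<longrightarrow> Lp_norm M p h \<le> c \<longrightarrow>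
      (\<integral>\<^sup>+ x. ennreal (norm (g x *\<^sub>R h x)) \<partial>M) \<le> ennreal (K * c)"
  proof (cases "p = \<infinity> \<or> q = \<infinity>")
    case True
    \<comment> \<open>In \<open>ennreal\<close>, 1 / \<infinity> = 0, so an infinite exponent forces
      its conjugate to be 1.\<close>
    then consider "p = \<infinity>" "q = 1" | "p = 1" "q = \<infinity>"
    proof
      assume "p = \<infinity>"
      moreover have "q = 1" using q \<open>p = \<infinity>\<close> by - (rule ennreal_one_divide_eq_1D, simp)
      ultimately show ?thesis using that by blast
    next
      assume "q = \<infinity>"
      moreover have "p = 1" using q \<open>q = \<infinity>\<close> by - (rule ennreal_one_divide_eq_1D, simp)
      ultimately show ?thesis using that by blast
    qed
    then show ?thesis
    proof cases
      case 1
      define I where "I = (\<integral>\<^sup>+ x. ennreal \<bar>g x\<bar> \<partial>M)"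
      have "I < \<infinity>" using g 1 by (simp add: Lp_space_def I_def)
      then have I: "I = ennreal (enn2real I)" by simp
      show ?thesis
      proof (intro exI[of _ "enn2real I"] conjI allI impI)
        fix h :: "'a \<Rightarrow> 'b" and c :: real
        assume c: "0 < c" and h: "h \<in> Lp_space M p" "Lp_norm M p h \<le> c"
        have "AE x in M. norm (h x) \<le> c"
          using Lp_norm_le_iff[OF p Lp_space_measurable[OF h(1)] c] h 1 by simp
        then have "(\<integral>\<^sup>+ x. ennreal (norm (g x *\<^sub>R h x)) \<partial>M) \<le> (\<integral>\<^sup>+ x. ennreal \<bar>g x\<bar> * ennreal c \<partial>M)"
          using c by (intro nn_integral_mono_AE)
            (auto elim!: eventually_mono simp: ennreal_mult[symmetric] intro!: ennreal_leI mult_left_mono)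
        also have "\<dots> = ennreal (enn2real I * c)"
          using c I by (simp add: nn_integral_multc I_def[symmetric] ennreal_mult)
        finally show "(\<integral>\<^sup>+ x. ennreal (norm (g x *\<^sub>R h x)) \<partial>M) \<le> ennreal (enn2real I * c)" .
      qed simp
    next
      case 2
      have "AE x in M. norm (g x) \<le> Lp_norm M q g + 1"
        using Lp_norm_le_iff[of q g M "Lp_norm M q g + 1"] g 2 Lp_norm_nonneg[of M q g] gm by simp
      define G where "G = Lp_norm M q g + 1"
      have G: "0 \<le> G" "AE x in M. \<bar>g x\<bar> \<le> G"
        using Lp_norm_nonneg[of M q g] \<open>AE x in M. norm (g x) \<le> Lp_norm M q g + 1\<close> by (auto simp: G_def)
      show ?thesis
      proof (intro exI[of _ G] conjI allI impI)
        fix h :: "'a \<Rightarrow> 'b" and c :: real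
        assume c: "0 < c" and h: "h \<in> Lp_space M p" "Lp_norm M p h \<le> c"
        have [measurable]: "h \<in> borel_measurable M" using h(1) by (rule Lp_space_measurable)
        have I: "(\<integral>\<^sup>+ x. ennreal (norm (h x) / c) \<partial>M) \<le> 1"
          using Lp_norm_le_iff[OF p Lp_space_measurable[OF h(1)] c] h c 2 by simp
        have "(\<integral>\<^sup>+ x. ennreal (norm (g x *\<^sub>R h x)) \<partial>M) \<le> (\<integral>\<^sup>+ x. ennreal (G * c) * ennreal (norm (h x) / c) \<partial>M)"
          using G(2)
        proof (intro nn_integral_mono_AE, eventually_elim)
          case (elim x)
          then show ?case using c G(1)
            by (auto simp: ennreal_mult[symmetric] intro!: ennreal_leI mult_right_mono)
        qed
        also have "\<dots> = ennreal (G * c) * (\<integral>\<^sup>+ x. ennreal (norm (h x) / c) \<partial>M)"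
          by (simp add: nn_integral_cmult)
        also have "\<dots> \<le> ennreal (G * c) * 1" using I by (intro mult_left_mono) auto
        finally show "(\<integral>\<^sup>+ x. ennreal (norm (g x *\<^sub>R h x)) \<partial>M) \<le> ennreal (G * c)" by simp
      qed (use G in simp)
    qed
  next
    case False
    define P where "P = enn2real p"
    define Q where "Q = enn2real q"
    have pP: "p = ennreal P" and qQ: "q = ennreal Q" using False by (auto simp: P_def Q_def less_top)
    have P1: "1 \<le> P" using p False by (simp add: P_def enn2real_ge_1)
    have Q0: "0 < Q"
    proof -
      have "q \<noteq> 0" using q by (intro notI) (simp add: ennreal_divide_zero)
      then show ?thesis by (simp add: qQ ennreal_eq_0_iff not_le)
    qed
    have "1 / p = ennreal (1 / P)" "1 / q = ennreal (1 / Q)"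
      unfolding pP qQ using P1 Q0 by (simp_all add: divide_ennreal flip: ennreal_1)
    with q have "ennreal (1 / P + 1 / Q) = ennreal 1"
      using P1 Q0 by simp
    then have PQ: "1 / P + 1 / Q = 1" using P1 Q0 by (subst (asm) ennreal_inj) auto
    then have P: "1 < P" using P1 Q0 by (cases "P = 1") auto
    then have "0 < 1 / P" by simp
    then have "1 / Q < 1" using PQ by linarith
    then have Q: "1 < Q" using Q0 by simp
    define I where "I = (\<integral>\<^sup>+ x. ennreal (\<bar>g x\<bar> powr Q) \<partial>M)"
    have "I < \<infinity>" using g False by (simp add: Lp_space_def I_def Q_def)
    then have I: "I = ennreal (enn2real I)" by simp
    show ?thesis
    proof (intro exI[of _ "1 + enn2real I"] conjI allI impI)
      fix h :: "'a \<Rightarrow> 'b" and c :: real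
      assume c: "0 < c" and h: "h \<in> Lp_space M p" "Lp_norm M p h \<le> c"
      have [measurable]: "h \<in> borel_measurable M" using h(1) by (rule Lp_space_measurable)
      have J: "(\<integral>\<^sup>+ x. ennreal ((norm (h x) / c) powr P) \<partial>M) \<le> 1"
        using Lp_norm_le_iff[OF p Lp_space_measurable[OF h(1)] c] h False by (simp add: P_def)
      have pt: "norm (g x *\<^sub>R h x) \<le> c * ((norm (h x) / c) powr P + \<bar>g x\<bar> powr Q)" for x
      proof -
        have "norm (h x) / c * \<bar>g x\<bar> \<le> (norm (h x) / c) powr P / P + \<bar>g x\<bar> powr Q / Q"
          using P Q PQ c by (intro Youngs_inequality) auto
        also have "\<dots> \<le> (norm (h x) / c) powr P + \<bar>g x\<bar> powr Q"
          using P Q by (intro add_mono) (auto simp: divide_le_eq mult_le_cancel_left1)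
        finally show ?thesis using c by (simp add: field_simps)
      qed
      have "(\<integral>\<^sup>+ x. ennreal (norm (g x *\<^sub>R h x)) \<partial>M)
          \<le> (\<integral>\<^sup>+ x. ennreal c * (ennreal ((norm (h x) / c) powr P) + ennreal (\<bar>g x\<bar> powr Q)) \<partial>M)"
        using c by (intro nn_integral_mono ennreal_leI[OF pt, THEN order_trans]) (auto simp: ennreal_mult)
      also have "\<dots> = ennreal c * ((\<integral>\<^sup>+ x. ennreal ((norm (h x) / c) powr P) \<partial>M) + I)"
        by (simp add: nn_integral_cmult nn_integral_add I_def)
      also have "\<dots> \<le> ennreal c * (1 + I)" using J by (intro mult_left_mono add_right_mono) auto
      also have "\<dots> = ennreal ((1 + enn2real I) * c)"
        using c by (subst I) (simp add: ennreal_mult mult.commute)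
      finally show "(\<integral>\<^sup>+ x. ennreal (norm (g x *\<^sub>R h x)) \<partial>M) \<le> ennreal ((1 + enn2real I) * c)" .
    qed simp
  qed
  then obtain K where K: "0 \<le> K"
    and le: "\<And>(h :: 'a \<Rightarrow> 'b) c. 0 < c \<Longrightarrow> h \<in> Lp_space M p \<Longrightarrow> Lp_norm M p h \<le> c \<Longrightarrow>
      (\<integral>\<^sup>+ x. ennreal (norm (g x *\<^sub>R h x)) \<partial>M) \<le> ennreal (K * c)"
    by blast
  show thesis
  proof (rule that[OF K], intro conjI)
    fix h :: "'a \<Rightarrow> 'b" assume h: "h \<in> Lp_space M p"
    have [measurable]: "h \<in> borel_measurable M" using h by (rule Lp_space_measurable)
    have "(\<integral>\<^sup>+ x. ennreal (norm (g x *\<^sub>R h x)) \<partial>M) \<le> ennreal (K * (Lp_norm M p h + 1))"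
      using le[of "Lp_norm M p h + 1" h] h Lp_norm_nonneg[of M p h] by simp
    also have "\<dots> < \<infinity>" by simp
    finally show int: "integrable M (\<lambda>x. g x *\<^sub>R h x)" by (intro integrableI_bounded) auto
    have *: "norm (\<integral>x. g x *\<^sub>R h x \<partial>M) \<le> K * c" if "0 < c" "Lp_norm M p h \<le> c" for c
    proof -
      have "ennreal (norm (\<integral>x. g x *\<^sub>R h x \<partial>M)) \<le> (\<integral>\<^sup>+ x. ennreal (norm (g x *\<^sub>R h x)) \<partial>M)"
        by (rule integral_norm_bound_ennreal[OF int])
      also have "\<dots> \<le> ennreal (K * c)" using le[OF that(1) h that(2)] .
      finally show ?thesis using K that by (simp add: ennreal_le_iff)
    qed
    have "norm (\<integral>x. g x *\<^sub>R h x \<partial>M) \<le> K * Lp_norm M p h + \<epsilon>" if "0 < \<epsilon>" for \<epsilon>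
    proof -
      \<comment> \<open>The slack \<epsilon> / (K + 1) costs at most \<epsilon> after multiplication
        by K, also when K = 0.\<close>
      have "norm (\<integral>x. g x *\<^sub>R h x \<partial>M) \<le> K * (Lp_norm M p h + \<epsilon> / (K + 1))"
        using K that Lp_norm_nonneg[of M p h] by (intro *) (auto intro: add_nonneg_pos)
      also have "\<dots> \<le> K * Lp_norm M p h + \<epsilon>"
        using K that by (simp add: field_simps)
      finally show ?thesis .
    qed
    then show "norm (\<integral>x. g x *\<^sub>R h x \<partial>M) \<le> K * Lp_norm M p h"
      by (rule field_le_epsilon)
  qed
qed

subsection \<open>Resolvents\<close>

locale Lp_operator =
  fixes M :: "'a measure" and p :: ennreal and T :: "('a \<Rightarrow> complex) \<Rightarrow> 'a \<Rightarrow> complex"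
  assumes exponent: "1 \<le> p" and bounded: "bounded_operator M p T"
begin

lemma closed: "h \<in> Lp_space M p \<Longrightarrow> T h \<in> Lp_space M p"
  using bounded by (simp add: bounded_operator_def)

lemma lincomb_AE:
  "u \<in> Lp_space M p \<Longrightarrow> v \<in> Lp_space M p \<Longrightarrow>
   AE x in M. T (\<lambda>y. a * u y + b * v y) x = a * T u x + b * T v x"
  using bounded by (simp add: bounded_operator_def)

lemma diff_AE:
  "u \<in> Lp_space M p \<Longrightarrow> v \<in> Lp_space M p \<Longrightarrow> AE x in M. T (\<lambda>y. u y - v y) x = T u x - T v x"
  using lincomb_AE[of u v 1 "-1"] by simp

text \<open>A strictly positive constant is asked for because C / cmod z will be a contraction ratio
  and 1 / C a radius.\<close>

lemma bound:
  obtains C where "0 < C" "\<And>h. h \<in> Lp_space M p \<Longrightarrow> Lp_norm M p (T h) \<le> C * Lp_norm M p h"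
proof -
  obtain C where C: "\<And>h. h \<in> Lp_space M p \<Longrightarrow> Lp_norm M p (T h) \<le> C * Lp_norm M p h"
    using bounded unfolding bounded_operator_def by blast
  show thesis
  proof (rule that[of "max C 1"])
    fix h :: "'a \<Rightarrow> complex" assume "h \<in> Lp_space M p"
    then have "Lp_norm M p (T h) \<le> C * Lp_norm M p h" by (rule C)
    also have "\<dots> \<le> max C 1 * Lp_norm M p h" by (intro mult_right_mono Lp_norm_nonneg) simp
    finally show "Lp_norm M p (T h) \<le> max C 1 * Lp_norm M p h" .
  qed simp
qed

text \<open>The difference of the arguments has norm zero, hence so has its image. This is what
  allows almost everywhere identities to be used inside an argument of \<open>T\<close>.\<close>

lemma cong_AE:
  assumes u: "u \<in> Lp_space M p" and v: "v \<in> Lp_space M p" and eq: "AE x in M. u x = v x"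
  shows "AE x in M. T u x = T v x"
proof -
  obtain C where C: "0 < C" "\<And>h. h \<in> Lp_space M p \<Longrightarrow> Lp_norm M p (T h) \<le> C * Lp_norm M p h"
    using bound by blast
  have d: "(\<lambda>y. u y - v y) \<in> Lp_space M p" using exponent u v by (rule Lp_space_diff)
  have "Lp_norm M p (\<lambda>y. u y - v y) = 0"
    using eq by (intro Lp_norm_zero exponent Lp_space_measurable[OF d]) auto
  then have "Lp_norm M p (T (\<lambda>y. u y - v y)) \<le> 0" using C(2)[OF d] by simp
  then have "AE x in M. T (\<lambda>y. u y - v y) x = 0"
    using Lp_norm_zeroD[OF exponent closed[OF d]] by simp
  then show ?thesis using diff_AE[OF u v] by eventually_elim simp
qed

lemma funpow_closed: "h \<in> Lp_space M p \<Longrightarrow> (T ^^ n) h \<in> Lp_space M p"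
  by (induction n) (auto intro: closed)

lemma funpow_bound:
  assumes C: "0 \<le> C" "\<And>h. h \<in> Lp_space M p \<Longrightarrow> Lp_norm M p (T h) \<le> C * Lp_norm M p h"
    and h: "h \<in> Lp_space M p"
  shows "Lp_norm M p ((T ^^ n) h) \<le> C ^ n * Lp_norm M p h"
proof (induction n)
  case (Suc n)
  have "Lp_norm M p ((T ^^ Suc n) h) \<le> C * Lp_norm M p ((T ^^ n) h)"
    using C(2) funpow_closed[OF h] by simp
  also have "\<dots> \<le> C * (C ^ n * Lp_norm M p h)" using Suc C by (intro mult_left_mono)
  finally show ?case by (simp add: mult.assoc)
qed simp

lemma funpow_operator: "Lp_operator M p (T ^^ n)"
proof
  obtain C where C: "0 < C" "\<And>h. h \<in> Lp_space M p \<Longrightarrow> Lp_norm M p (T h) \<le> C * Lp_norm M p h"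
    using bound by blast
  have "AE x in M. (T ^^ n) (\<lambda>y. a * u y + b * v y) x = a * (T ^^ n) u x + b * (T ^^ n) v x"
    if u: "u \<in> Lp_space M p" and v: "v \<in> Lp_space M p" for u v a b
  proof (induction n)
    case (Suc n)
    have "AE x in M. T ((T ^^ n) (\<lambda>y. a * u y + b * v y)) x = T (\<lambda>y. a * (T ^^ n) u y + b * (T ^^ n) v y) x"
      using u v by (intro cong_AE Suc funpow_closed Lp_space_lincomb exponent)
    moreover have "AE x in M. T (\<lambda>y. a * (T ^^ n) u y + b * (T ^^ n) v y) x
        = a * T ((T ^^ n) u) x + b * T ((T ^^ n) v) x"
      using u v by (intro lincomb_AE funpow_closed)
    ultimately show ?case by eventually_elim simp
  qed simp
  then show "bounded_operator M p (T ^^ n)"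
    using funpow_closed funpow_bound[OF less_imp_le[OF C(1)] C(2)]
    unfolding bounded_operator_def by blast
qed (rule exponent)

section \<open>Neumann iteration and boundedness of the spectrum\<close>

text \<open>The reverse triangle inequality. For C < cmod z it yields both the injectivity of z - T
  and the norm bound of its inverse.\<close>

lemma lower_bound:
  assumes C: "\<And>h. h \<in> Lp_space M p \<Longrightarrow> Lp_norm M p (T h) \<le> C * Lp_norm M p h"
    and h: "h \<in> Lp_space M p" and "z \<noteq> 0"
  shows "(cmod z - C) * Lp_norm M p h \<le> Lp_norm M p (\<lambda>x. z * h x - T h x)"
proof -
  have zh: "(\<lambda>x. z * h x) \<in> Lp_space M p" using exponent h by (rule Lp_space_cmult)
  \<comment> \<open>The homogeneity estimate is one-sided; the opposite direction comes from
    applying it to z h with the factor 1 / z.\<close>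
  have "Lp_norm M p h \<le> Lp_norm M p (\<lambda>x. z * h x) / cmod z"
    using Lp_norm_cmult_le[OF exponent zh, of "1 / z"] \<open>z \<noteq> 0\<close> by (simp add: norm_divide)
  then have "cmod z * Lp_norm M p h \<le> Lp_norm M p (\<lambda>x. z * h x)"
    using \<open>z \<noteq> 0\<close> by (simp add: field_simps)
  also have "\<dots> \<le> Lp_norm M p (\<lambda>x. z * h x - T h x) + Lp_norm M p (T h)"
    using Lp_norm_triangle[OF exponent Lp_space_diff[OF exponent zh closed[OF h]] closed[OF h]] by simp
  also have "\<dots> \<le> Lp_norm M p (\<lambda>x. z * h x - T h x) + C * Lp_norm M p h"
    using C[OF h] by simp
  finally show ?thesis by (simp add: algebra_simps)
qed

text \<open>The iteration \<open>u \<mapsto> (h + T u) / z\<close> is a contraction.\<close>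

lemma resolvent_equation_solvable:
  assumes fin: "p \<noteq> \<infinity> \<Longrightarrow> finite_measure M"
    and C: "0 < C" "\<And>h. h \<in> Lp_space M p \<Longrightarrow> Lp_norm M p (T h) \<le> C * Lp_norm M p h"
    and z: "C < cmod z" and h: "h \<in> Lp_space M p"
  obtains v where "v \<in> Lp_space M p" "AE x in M. z * v x - T v x = h x"
proof -
  define \<theta> where "\<theta> = C / cmod z"
  have z0: "z \<noteq> 0" "0 < cmod z" using z C by auto
  have \<theta>: "0 < \<theta>" "\<theta> < 1" using C z z0 by (auto simp: \<theta>_def)
  define u where "u n = ((\<lambda>v x. (1 / z) * h x + (1 / z) * T v x) ^^ n) (\<lambda>_. 0)" for n
  have u0: "u 0 = (\<lambda>_. 0)" by (simp add: u_def)
  have uS: "u (Suc n) = (\<lambda>x. (1 / z) * h x + (1 / z) * T (u n) x)" for n by (simp add: u_def)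
  have u: "u n \<in> Lp_space M p" for n
  proof (induction n)
    case 0
    then show ?case using Lp_norm_zero(1)[OF exponent, of "\<lambda>_. 0 :: complex" M] by (simp add: u0)
  next
    case (Suc n)
    then show ?case unfolding uS by (intro Lp_space_lincomb exponent h closed)
  qed
  have d: "(\<lambda>x. u m x - u n x) \<in> Lp_space M p" for m n using exponent u u by (rule Lp_space_diff)
  define K where "K = Lp_norm M p (\<lambda>x. u 1 x - u 0 x) + 1"
  have K: "0 < K" using Lp_norm_nonneg[of M p "\<lambda>x. u 1 x - u 0 x"] by (simp add: K_def)
  have le: "Lp_norm M p (\<lambda>x. u (Suc n) x - u n x) \<le> K * \<theta> ^ n" for n
  proof (induction n)
    case 0
    then show ?case by (simp add: K_def)
  next
    case (Suc n)
    have "AE x in M. u (Suc (Suc n)) x - u (Suc n) x = (1 / z) * T (\<lambda>x. u (Suc n) x - u n x) x"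
      using diff_AE[OF u[of "Suc n"] u[of n]]
      by eventually_elim (simp add: uS[of "Suc n"] uS[of n] algebra_simps flip: diff_divide_distrib)
    then have "Lp_norm M p (\<lambda>x. u (Suc (Suc n)) x - u (Suc n) x)
        = Lp_norm M p (\<lambda>x. (1 / z) * T (\<lambda>x. u (Suc n) x - u n x) x)"
      by (intro Lp_norm_cong_AE Lp_space_cmult exponent closed d Lp_space_measurable[OF d])
    also have "\<dots> \<le> cmod (1 / z) * Lp_norm M p (T (\<lambda>x. u (Suc n) x - u n x))"
      by (intro Lp_norm_cmult_le exponent closed d)
    also have "\<dots> \<le> cmod (1 / z) * (C * (K * \<theta> ^ n))"
      using Suc C(1) by (intro mult_left_mono order_trans[OF C(2)[OF d]]) auto
    also have "\<dots> = K * \<theta> ^ Suc n" by (simp add: \<theta>_def norm_divide)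
    finally show ?case .
  qed
  obtain v where v: "v \<in> Lp_space M p"
    and conv: "\<And>n. Lp_norm M p (\<lambda>x. v x - u n x) \<le> K * \<theta> ^ n / (1 - \<theta>)"
    using Lp_geometric_Cauchy_converges[OF exponent fin u le K \<theta>] by blast
  have vd: "(\<lambda>x. v x - u n x) \<in> Lp_space M p" for n using exponent v u by (rule Lp_space_diff)
  let ?w = "\<lambda>x. (z * v x - T v x) - h x"
  have w: "?w \<in> Lp_space M p"
    using v h by (intro Lp_space_diff exponent Lp_space_cmult closed)
  have "Lp_norm M p ?w \<le> (cmod z + C) * (K * \<theta> ^ n / (1 - \<theta>))" for n
  proof -
    \<comment> \<open>By the recursion, z u(n+1) = h + T u(n), so the residual of the limit v is z
      (v - u(n+1)) - T (v - u(n)), and both terms tend to 0.\<close>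
    let ?w' = "\<lambda>x. z * (v x - u (Suc n) x) - T (\<lambda>x. v x - u n x) x"
    have "AE x in M. ?w x = ?w' x"
      using diff_AE[OF v u[of n]]
    proof eventually_elim
      case (elim x)
      show ?case unfolding elim uS[of n] using z0 by (simp add: algebra_simps)
    qed
    then have "Lp_norm M p ?w = Lp_norm M p ?w'"
      by (intro Lp_norm_cong_AE Lp_space_diff Lp_space_cmult exponent closed vd Lp_space_measurable[OF w])
    also have "\<dots> \<le> Lp_norm M p (\<lambda>x. z * (v x - u (Suc n) x)) + Lp_norm M p (T (\<lambda>x. v x - u n x))"
      by (intro Lp_norm_diff_le Lp_space_cmult exponent closed vd)
    also have "\<dots> \<le> cmod z * Lp_norm M p (\<lambda>x. v x - u (Suc n) x) + C * Lp_norm M p (\<lambda>x. v x - u n x)"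
      by (intro add_mono Lp_norm_cmult_le C vd exponent)
    also have "\<dots> \<le> cmod z * (K * \<theta> ^ n / (1 - \<theta>)) + C * (K * \<theta> ^ n / (1 - \<theta>))"
    proof (intro add_mono mult_left_mono conv order_trans[OF conv[of "Suc n"]] divide_right_mono)
      show "\<theta> ^ Suc n \<le> \<theta> ^ n" using \<theta> by (intro power_decreasing) auto
    qed (use K \<theta> C in auto)
    finally show ?thesis unfolding distrib_right .
  qed
  moreover have "(\<lambda>n. (cmod z + C) * (K * \<theta> ^ n / (1 - \<theta>))) \<longlonglongrightarrow> (cmod z + C) * (K * 0 / (1 - \<theta>))"
    using \<theta> by (intro tendsto_intros LIMSEQ_power_zero) auto
  ultimately have "Lp_norm M p ?w \<le> (cmod z + C) * (K * 0 / (1 - \<theta>))"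
    by (intro LIMSEQ_le_const) auto
  then have "AE x in M. ?w x = 0" using Lp_norm_zeroD[OF exponent w] by simp
  then show thesis using that[OF v] by simp
qed

text \<open>The inverse picks an arbitrary solution of the resolvent equation for each right-hand
  side. Since solutions are unique almost everywhere, such a choice is automatically linear almost
  everywhere and also a left inverse.\<close>

lemma not_in_spectrum:
  assumes fin: "p \<noteq> \<infinity> \<Longrightarrow> finite_measure M"
    and C: "0 < C" "\<And>h. h \<in> Lp_space M p \<Longrightarrow> Lp_norm M p (T h) \<le> C * Lp_norm M p h"
    and z: "C < cmod z"
  shows "z \<notin> spectrum M p T"
proof -
  have z0: "z \<noteq> 0" using z C by auto
  have inj: "AE x in M. u x = v x"
    if u: "u \<in> Lp_space M p" and v: "v \<in> Lp_space M p"
      and eq: "AE x in M. z * u x - T u x = z * v x - T v x" for u v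
  proof -
    let ?d = "\<lambda>x. u x - v x"
    have d: "?d \<in> Lp_space M p" using exponent u v by (rule Lp_space_diff)
    have "AE x in M. z * ?d x - T ?d x = 0"
      using eq diff_AE[OF u v]
    proof eventually_elim
      case (elim x)
      show ?case unfolding elim(2) using elim(1) by (simp add: algebra_simps)
    qed
    then have "Lp_norm M p (\<lambda>x. z * ?d x - T ?d x) = 0"
      by (intro Lp_norm_zero(2) exponent Lp_space_measurable[OF Lp_space_diff[OF exponent]] Lp_space_cmult closed d)
    then have "(cmod z - C) * Lp_norm M p ?d \<le> 0" using lower_bound[OF C(2) d z0] by simp
    then have "Lp_norm M p ?d \<le> 0" using z by (simp add: mult_le_0_iff)
    then have "AE x in M. ?d x = 0" using Lp_norm_zeroD[OF exponent d] by simp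
    then show ?thesis by simp
  qed
  define R where "R h = (SOME v. v \<in> Lp_space M p \<and> (AE x in M. z * v x - T v x = h x))" for h
  have R: "R h \<in> Lp_space M p" "AE x in M. z * R h x - T (R h) x = h x" if h: "h \<in> Lp_space M p" for h
  proof -
    have ex: "\<exists>v. v \<in> Lp_space M p \<and> (AE x in M. z * v x - T v x = h x)"
      using resolvent_equation_solvable[OF fin C z h] by blast
    have "R h \<in> Lp_space M p \<and> (AE x in M. z * R h x - T (R h) x = h x)"
      unfolding R_def by (rule someI_ex[OF ex])
    then show "R h \<in> Lp_space M p" "AE x in M. z * R h x - T (R h) x = h x" by auto
  qed
  have Tz: "(\<lambda>x. z * h x - T h x) \<in> Lp_space M p" if "h \<in> Lp_space M p" for h
    using that by (intro Lp_space_diff Lp_space_cmult exponent closed)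
  have left: "AE x in M. R (\<lambda>y. z * h y - T h y) x = h x" if h: "h \<in> Lp_space M p" for h
    by (rule inj[OF R(1)[OF Tz[OF h]] h R(2)[OF Tz[OF h]]])
  have "AE x in M. R (\<lambda>y. a * u y + b * v y) x = a * R u x + b * R v x"
    if u: "u \<in> Lp_space M p" and v: "v \<in> Lp_space M p" for u v a b
  proof (rule inj)
    have uv: "(\<lambda>y. a * u y + b * v y) \<in> Lp_space M p" using exponent u v by (rule Lp_space_lincomb)
    show "R (\<lambda>y. a * u y + b * v y) \<in> Lp_space M p" using uv by (rule R)
    show "(\<lambda>x. a * R u x + b * R v x) \<in> Lp_space M p" using u v by (intro Lp_space_lincomb exponent R)
    show "AE x in M. z * R (\<lambda>y. a * u y + b * v y) x - T (R (\<lambda>y. a * u y + b * v y)) x =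
        z * (a * R u x + b * R v x) - T (\<lambda>x. a * R u x + b * R v x) x"
      using R(2)[OF uv] R(2)[OF u] R(2)[OF v] lincomb_AE[OF R(1)[OF u] R(1)[OF v], of a b]
    proof eventually_elim
      case (elim x)
      have "z * R (\<lambda>y. a * u y + b * v y) x - T (R (\<lambda>y. a * u y + b * v y)) x
          = a * (z * R u x - T (R u) x) + b * (z * R v x - T (R v) x)"
        using elim by simp
      also have "\<dots> = z * (a * R u x + b * R v x) - (a * T (R u) x + b * T (R v) x)"
        by (simp add: algebra_simps)
      finally show ?case using elim by simp
    qed
  qed
  moreover have "Lp_norm M p (R h) \<le> 1 / (cmod z - C) * Lp_norm M p h" if h: "h \<in> Lp_space M p" for h
  proof -
    have "(cmod z - C) * Lp_norm M p (R h) \<le> Lp_norm M p (\<lambda>x. z * R h x - T (R h) x)"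
      using C(2) R(1)[OF h] z0 by (rule lower_bound)
    also have "\<dots> = Lp_norm M p h"
      using R[OF h] by (intro Lp_norm_cong_AE h Lp_space_measurable[OF Tz])
    finally show ?thesis using z by (simp add: field_simps)
  qed
  ultimately have "bounded_operator M p R"
    using R(1) unfolding bounded_operator_def by blast
  then show ?thesis using left R(2) by (auto simp: spectrum_def)
qed

text \<open>The real-valued \<open>SUP\<close> in \<open>spectral_radius\<close> dominates the
  members of the set only if the set is bounded.\<close>

lemma bdd_above_spectrum:
  assumes "p \<noteq> \<infinity> \<Longrightarrow> finite_measure M"
  shows "bdd_above (cmod ` spectrum M p T)"
proof -
  obtain C where "0 < C" "\<And>h. h \<in> Lp_space M p \<Longrightarrow> Lp_norm M p (T h) \<le> C * Lp_norm M p h"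
    using bound by blast
  then have "cmod z \<le> C" if "z \<in> spectrum M p T" for z
    using not_in_spectrum[OF assms, of C z] that by force
  then show ?thesis by (intro bdd_aboveI) auto
qed

section \<open>The resolvent and its identity\<close>

text \<open>Meaningful only off the spectrum, where its values are determined up to almost
  everywhere equality.\<close>

definition resolvent :: "complex \<Rightarrow> ('a \<Rightarrow> complex) \<Rightarrow> 'a \<Rightarrow> complex" where
  "resolvent z = (SOME R. bounded_operator M p R \<and>
     (\<forall>h\<in>Lp_space M p.
        (AE x in M. R (\<lambda>y. z * h y - T h y) x = h x) \<and>
        (AE x in M. z * R h x - T (R h) x = h x)))"

context
  fixes z assumes z: "z \<notin> spectrum M p T"
begin

lemma resolvent_props:
  "bounded_operator M p (resolvent z) \<and>
     (\<forall>h\<in>Lp_space M p.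
        (AE x in M. resolvent z (\<lambda>y. z * h y - T h y) x = h x) \<and>
        (AE x in M. z * resolvent z h x - T (resolvent z h) x = h x))"
  using z unfolding spectrum_def resolvent_def mem_Collect_eq not_not by (rule someI_ex)

lemma resolvent_operator: "Lp_operator M p (resolvent z)"
  using resolvent_props exponent by unfold_locales auto

lemma resolvent_closed: "h \<in> Lp_space M p \<Longrightarrow> resolvent z h \<in> Lp_space M p"
  using Lp_operator.closed[OF resolvent_operator] .

lemma resolvent_right: "h \<in> Lp_space M p \<Longrightarrow> AE x in M. z * resolvent z h x - T (resolvent z h) x = h x"
  using resolvent_props by blast

lemma resolvent_unique:
  assumes u: "u \<in> Lp_space M p" and v: "v \<in> Lp_space M p" and eq: "AE x in M. z * u x - T u x = v x"
  shows "AE x in M. resolvent z v x = u x"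
proof -
  have "(\<lambda>x. z * u x - T u x) \<in> Lp_space M p"
    using u by (intro Lp_space_diff Lp_space_cmult exponent closed)
  then have "AE x in M. resolvent z (\<lambda>x. z * u x - T u x) x = resolvent z v x"
    using v eq by (rule Lp_operator.cong_AE[OF resolvent_operator])
  moreover have "AE x in M. resolvent z (\<lambda>y. z * u y - T u y) x = u x"
    using resolvent_props u by blast
  ultimately show ?thesis by eventually_elim simp
qed

end

text \<open>By uniqueness it suffices that the right-hand side solves the equation for z. With y the
  resolvent at w of v, applying z - T gives (z - T) y + (w - z) y = (w - T) y = v.\<close>

lemma resolvent_identity:
  assumes z: "z \<notin> spectrum M p T" and w: "w \<notin> spectrum M p T" and v: "v \<in> Lp_space M p"
  shows "AE x in M. resolvent z v x = resolvent w v x + (w - z) * resolvent z (resolvent w v) x"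
proof (rule resolvent_unique[OF z _ v])
  let ?y = "resolvent w v"
  have y: "?y \<in> Lp_space M p" and zy: "resolvent z ?y \<in> Lp_space M p"
    using v by (auto intro!: resolvent_closed z w)
  show "(\<lambda>x. ?y x + (w - z) * resolvent z ?y x) \<in> Lp_space M p"
    using y zy by (intro Lp_space_add Lp_space_cmult exponent)
  have "AE x in M. T (\<lambda>x. ?y x + (w - z) * resolvent z ?y x) x = T ?y x + (w - z) * T (resolvent z ?y) x"
    using lincomb_AE[OF y zy, of 1 "w - z"] by simp
  then show "AE x in M. z * (?y x + (w - z) * resolvent z ?y x) - T (\<lambda>x. ?y x + (w - z) * resolvent z ?y x) x = v x"
    using resolvent_right[OF z y] resolvent_right[OF w v]
  proof eventually_elim
    case (elim x)
    have "z * (?y x + (w - z) * resolvent z ?y x) - T (\<lambda>x. ?y x + (w - z) * resolvent z ?y x) x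
        = (w - z) * (z * resolvent z ?y x - T (resolvent z ?y) x) + z * ?y x - T ?y x"
      using elim(1) by (simp add: algebra_simps)
    also have "\<dots> = w * ?y x - T ?y x" unfolding elim(2) by (simp add: algebra_simps)
    finally show ?case using elim(3) by simp
  qed
qed

text \<open>An absorption argument: the resolvent identity bounds the norm of the resolvent at z by
  that at w plus half of itself. The resulting bound is uniform in z near w.\<close>

lemma resolvent_locally_bounded:
  assumes w: "w \<notin> spectrum M p T" and z: "z \<notin> spectrum M p T" and y: "y \<in> Lp_space M p"
    and C: "\<And>h. h \<in> Lp_space M p \<Longrightarrow> Lp_norm M p (resolvent w h) \<le> C * Lp_norm M p h"
    and near: "cmod (z - w) * C \<le> 1 / 2"
  shows "Lp_norm M p (resolvent z y) \<le> 2 * Lp_norm M p (resolvent w y)"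
proof -
  let ?zy = "resolvent z y"
  have wy: "resolvent w y \<in> Lp_space M p" and zy: "?zy \<in> Lp_space M p"
    and wzy: "resolvent w ?zy \<in> Lp_space M p"
    using y by (auto intro!: resolvent_closed w z)
  have "AE x in M. ?zy x = resolvent w y x + (w - z) * resolvent w ?zy x"
    using resolvent_identity[OF w z y] by eventually_elim (simp add: algebra_simps)
  then have "Lp_norm M p ?zy = Lp_norm M p (\<lambda>x. resolvent w y x + (w - z) * resolvent w ?zy x)"
    using wy wzy by (intro Lp_norm_cong_AE Lp_space_measurable[OF zy] Lp_space_add Lp_space_cmult exponent)
  also have "\<dots> \<le> Lp_norm M p (resolvent w y) + Lp_norm M p (\<lambda>x. (w - z) * resolvent w ?zy x)"
    using wy wzy by (intro Lp_norm_triangle Lp_space_cmult exponent)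
  also have "\<dots> \<le> Lp_norm M p (resolvent w y) + cmod (w - z) * Lp_norm M p (resolvent w ?zy)"
    using Lp_norm_cmult_le[OF exponent wzy] by simp
  also have "\<dots> \<le> Lp_norm M p (resolvent w y) + cmod (w - z) * (C * Lp_norm M p ?zy)"
    using C[OF zy] by (intro add_left_mono mult_left_mono) auto
  also have "\<dots> \<le> Lp_norm M p (resolvent w y) + 1 / 2 * Lp_norm M p ?zy"
    using mult_right_mono[OF near Lp_norm_nonneg[of M p ?zy]] by (simp add: norm_minus_commute mult.assoc)
  finally show ?thesis by simp
qed

section \<open>Scalar functions of the resolvent\<close>

context
  fixes \<phi> :: "('a \<Rightarrow> complex) \<Rightarrow> complex" and K :: real
  assumes functional_lincomb: "\<And>a b u v. u \<in> Lp_space M p \<Longrightarrow> v \<in> Lp_space M p \<Longrightarrow>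
      \<phi> (\<lambda>x. a * u x + b * v x) = a * \<phi> u + b * \<phi> v"
    and functional_bound: "\<And>u. u \<in> Lp_space M p \<Longrightarrow> cmod (\<phi> u) \<le> K * Lp_norm M p u"
    and K_nonneg: "0 \<le> K"
begin

lemma functional_cong_AE:
  assumes u: "u \<in> Lp_space M p" and v: "v \<in> Lp_space M p" and eq: "AE x in M. u x = v x"
  shows "\<phi> u = \<phi> v"
proof -
  have d: "(\<lambda>x. u x - v x) \<in> Lp_space M p" using exponent u v by (rule Lp_space_diff)
  have "Lp_norm M p (\<lambda>x. u x - v x) = 0"
    using eq by (intro Lp_norm_zero exponent Lp_space_measurable[OF d]) auto
  then have "\<phi> (\<lambda>x. u x - v x) = 0" using functional_bound[OF d] by simp
  then show ?thesis using functional_lincomb[OF u v, of 1 "-1"] by simp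
qed

text \<open>Using the resolvent identity twice expands the function to second order at w: linear
  coefficient \<open>- \<phi> ?y\<close>, remainder (w - z)^2 times a quantity that local
  boundedness controls uniformly near w. The open set \<open>S\<close> off the spectrum is supplied
  by the caller, so nothing about the topology of the spectrum enters.\<close>

lemma functional_resolvent_derivative:
  assumes S: "open S" "S \<inter> spectrum M p T = {}" "w \<in> S" and h: "h \<in> Lp_space M p"
  shows "((\<lambda>z. \<phi> (resolvent z h)) has_field_derivative - \<phi> (resolvent w (resolvent w h))) (at w)"
proof -
  have w: "w \<notin> spectrum M p T" using S by blast
  obtain C where C: "0 < C"
    "\<And>u. u \<in> Lp_space M p \<Longrightarrow> Lp_norm M p (resolvent w u) \<le> C * Lp_norm M p u"
    using Lp_operator.bound[OF resolvent_operator[OF w]] by blast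
  let ?v = "resolvent w h"
  let ?y = "resolvent w ?v"
  have v: "?v \<in> Lp_space M p" and y: "?y \<in> Lp_space M p"
    using h by (auto intro!: resolvent_closed w)
  define L where "L = K * (2 * Lp_norm M p (resolvent w ?y))"
  have quot: "norm ((\<phi> (resolvent z h) - \<phi> ?v) / (z - w) - (- \<phi> ?y)) \<le> L * cmod (z - w)"
    if zS: "z \<in> S" and near: "cmod (z - w) < 1 / (2 * C)" and "z \<noteq> w" for z
  proof -
    have z: "z \<notin> spectrum M p T" using S zS by blast
    have zv: "resolvent z ?v \<in> Lp_space M p" and zy: "resolvent z ?y \<in> Lp_space M p"
      and zh: "resolvent z h \<in> Lp_space M p"
      using v y h by (auto intro!: resolvent_closed z)
    have "\<phi> (resolvent z h) = \<phi> (\<lambda>x. 1 * ?v x + (w - z) * resolvent z ?v x)"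
      using resolvent_identity[OF z w h]
      by (intro functional_cong_AE zh Lp_space_lincomb exponent v zv) simp
    then have 1: "\<phi> (resolvent z h) = \<phi> ?v + (w - z) * \<phi> (resolvent z ?v)"
      using functional_lincomb[OF v zv, of 1 "w - z"] by simp
    have "\<phi> (resolvent z ?v) = \<phi> (\<lambda>x. 1 * ?y x + (w - z) * resolvent z ?y x)"
      using resolvent_identity[OF z w v]
      by (intro functional_cong_AE zv Lp_space_lincomb exponent y zy) simp
    then have 2: "\<phi> (resolvent z ?v) = \<phi> ?y + (w - z) * \<phi> (resolvent z ?y)"
      using functional_lincomb[OF y zy, of 1 "w - z"] by simp
    have "(\<phi> (resolvent z h) - \<phi> ?v) / (z - w) = - \<phi> (resolvent z ?v)"
      unfolding 1 using \<open>z \<noteq> w\<close> by (simp add: divide_simps) (simp add: algebra_simps)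
    then have eq: "norm ((\<phi> (resolvent z h) - \<phi> ?v) / (z - w) - (- \<phi> ?y)) = cmod (\<phi> (resolvent z ?y)) * cmod (z - w)"
      by (simp add: 2 norm_mult norm_minus_commute)
    have "Lp_norm M p (resolvent z ?y) \<le> 2 * Lp_norm M p (resolvent w ?y)"
      using near C(1) by (intro resolvent_locally_bounded[OF w z y C(2)]) (auto simp: field_simps)
    then have "K * Lp_norm M p (resolvent z ?y) \<le> L"
      using K_nonneg by (simp add: L_def mult_left_mono)
    then have "cmod (\<phi> (resolvent z ?y)) \<le> L"
      using functional_bound[OF zy] by simp
    then show ?thesis unfolding eq by (rule mult_right_mono) simp
  qed
  have ev: "\<forall>\<^sub>F z in at w. norm ((\<phi> (resolvent z h) - \<phi> ?v) / (z - w) - (- \<phi> ?y)) \<le> L * cmod (z - w)"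
  proof -
    have "\<forall>\<^sub>F z in nhds w. z \<in> S" using S by (intro eventually_nhds_in_open)
    then have "\<forall>\<^sub>F z in at w. z \<in> S" by (simp add: eventually_at_filter eventually_mono)
    moreover have "\<forall>\<^sub>F z in at w. cmod (z - w) < 1 / (2 * C)"
      using C(1) by (auto simp: eventually_at dist_norm intro!: exI[of _ "1 / (2 * C)"])
    moreover have "\<forall>\<^sub>F z in at w. z \<noteq> w" by (simp add: eventually_at_filter)
    ultimately show ?thesis by eventually_elim (rule quot)
  qed
  have "((\<lambda>z. L * cmod (z - w)) \<longlongrightarrow> L * cmod (w - w)) (at w)" by (intro tendsto_intros)
  then have "((\<lambda>z. (\<phi> (resolvent z h) - \<phi> ?v) / (z - w) - (- \<phi> ?y)) \<longlongrightarrow> 0) (at w)"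
    using ev by (intro Lim_null_comparison[OF ev]) simp
  then show ?thesis
    unfolding has_field_derivative_iff by (rule LIM_zero_cancel)
qed

text \<open>The Neumann series tested against \<phi>. Applying T^n and then \<phi> to the resolvent
  equation gives a one-step recursion, whence each partial sum has an exact remainder, of order (C /
  cmod z)^m. Only a scalar series has to converge.\<close>

lemma functional_resolvent_sums:
  assumes fin: "p \<noteq> \<infinity> \<Longrightarrow> finite_measure M"
    and C: "0 < C" "\<And>h. h \<in> Lp_space M p \<Longrightarrow> Lp_norm M p (T h) \<le> C * Lp_norm M p h"
    and z: "C < cmod z" and h: "h \<in> Lp_space M p"
  shows "(\<lambda>n. \<phi> ((T ^^ n) h) * (1 / z) ^ n) sums (z * \<phi> (resolvent z h))"
proof -
  have z': "z \<notin> spectrum M p T" using not_in_spectrum[OF fin C z] .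
  have z0: "z \<noteq> 0" using z C by auto
  let ?v = "resolvent z h"
  have v: "?v \<in> Lp_space M p" using h by (rule resolvent_closed[OF z'])
  have step: "z * \<phi> ((T ^^ n) ?v) = \<phi> ((T ^^ n) h) + \<phi> ((T ^^ Suc n) ?v)" for n
  proof -
    interpret Tn: Lp_operator M p "T ^^ n" by (rule funpow_operator)
    have "AE x in M. (T ^^ n) (\<lambda>x. z * ?v x + (- 1) * T ?v x) x = (T ^^ n) h x"
      using resolvent_right[OF z' h]
      by (intro Tn.cong_AE Lp_space_lincomb exponent v closed h) simp
    then have "AE x in M. z * (T ^^ n) ?v x + (- 1) * (T ^^ n) (T ?v) x = (T ^^ n) h x"
      using Tn.lincomb_AE[OF v closed[OF v], of z "- 1"] by eventually_elim simp
    then have "\<phi> (\<lambda>x. z * (T ^^ n) ?v x + (- 1) * (T ^^ n) (T ?v) x) = \<phi> ((T ^^ n) h)"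
      by (intro functional_cong_AE Lp_space_lincomb exponent funpow_closed v closed h)
    then have "z * \<phi> ((T ^^ n) ?v) - \<phi> ((T ^^ n) (T ?v)) = \<phi> ((T ^^ n) h)"
      using functional_lincomb[OF funpow_closed[OF v] funpow_closed[OF closed[OF v]], of z n "- 1" n] by simp
    then show ?thesis by (simp add: funpow_swap1 algebra_simps)
  qed
  have part: "z * \<phi> ?v = (\<Sum>n<m. \<phi> ((T ^^ n) h) * (1 / z) ^ n) + z * (1 / z) ^ m * \<phi> ((T ^^ m) ?v)" for m
  proof (induction m)
    case (Suc m)
    have "z * (1 / z) ^ m * \<phi> ((T ^^ m) ?v) = (1 / z) ^ m * (\<phi> ((T ^^ m) h) + \<phi> ((T ^^ Suc m) ?v))"
      using step[of m] by (simp add: mult.commute mult.left_commute)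
    then show ?case using Suc z0 by (simp add: algebra_simps)
  qed simp
  have "(\<lambda>m. z * (1 / z) ^ m * \<phi> ((T ^^ m) ?v)) \<longlonglongrightarrow> 0"
  proof (rule Lim_null_comparison[OF always_eventually], rule allI)
    fix m
    have "cmod (\<phi> ((T ^^ m) ?v)) \<le> K * (C ^ m * Lp_norm M p ?v)"
      using K_nonneg C(1) v
      by (intro order_trans[OF functional_bound] mult_left_mono funpow_bound C funpow_closed) auto
    then have "cmod z * (1 / cmod z) ^ m * cmod (\<phi> ((T ^^ m) ?v)) \<le> cmod z * (1 / cmod z) ^ m * (K * (C ^ m * Lp_norm M p ?v))"
      by (intro mult_left_mono) auto
    also have "\<dots> = cmod z * K * Lp_norm M p ?v * (C / cmod z) ^ m"
      by (simp add: power_divide field_simps)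
    finally show "norm (z * (1 / z) ^ m * \<phi> ((T ^^ m) ?v)) \<le> cmod z * K * Lp_norm M p ?v * (C / cmod z) ^ m"
      by (simp add: norm_mult norm_power norm_divide)
  next
    have "norm (C / cmod z) < 1" using C(1) z z0 by simp
    then have "(\<lambda>m. cmod z * K * Lp_norm M p ?v * (C / cmod z) ^ m) \<longlonglongrightarrow> cmod z * K * Lp_norm M p ?v * 0"
      by (intro tendsto_intros LIMSEQ_power_zero) auto
    then show "(\<lambda>m. cmod z * K * Lp_norm M p ?v * (C / cmod z) ^ m) \<longlonglongrightarrow> 0" by simp
  qed
  then have "(\<lambda>m. z * \<phi> ?v - z * (1 / z) ^ m * \<phi> ((T ^^ m) ?v)) \<longlonglongrightarrow> z * \<phi> ?v - 0"
    by (intro tendsto_intros)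
  moreover have "z * \<phi> ?v - z * (1 / z) ^ m * \<phi> ((T ^^ m) ?v) = (\<Sum>n<m. \<phi> ((T ^^ n) h) * (1 / z) ^ n)" for m
    using part[of m] by simp
  ultimately show ?thesis by (simp add: sums_def)
qed

text \<open>
  A weak form of Gelfand's formula: in the variable \<open>w = 1 / z\<close> the function
  \<open>z * \<phi> (resolvent z h)\<close> is holomorphic for \<open>cmod w < 1 / r\<close>, so its power series at \<open>0\<close>, which
  has the coefficients \<open>\<phi> ((T ^^ n) h)\<close>, converges there.
\<close>

lemma functional_funpow_growth:
  assumes fin: "p \<noteq> \<infinity> \<Longrightarrow> finite_measure M"
    and r: "0 \<le> r" "\<And>z. z \<in> spectrum M p T \<Longrightarrow> cmod z \<le> r" and \<rho>: "r < \<rho>"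
    and h: "h \<in> Lp_space M p"
  obtains B where "0 < B" "\<And>n. cmod (\<phi> ((T ^^ n) h)) \<le> B * \<rho> ^ n"
proof -
  obtain C where C: "0 < C" "\<And>h. h \<in> Lp_space M p \<Longrightarrow> Lp_norm M p (T h) \<le> C * Lp_norm M p h"
    using bound by blast
  \<comment> \<open>An intermediate radius: s is positive even if r = 0, and 1 / \<rho> lies
    strictly inside the disc of radius 1 / s.\<close>
  define s where "s = (r + \<rho>) / 2"
  have s: "r < s" "s < \<rho>" "0 < s" using r \<rho> by (auto simp: s_def)
  define A where "A = Abs_fps (\<lambda>n. \<phi> ((T ^^ n) h))"
  \<comment> \<open>This is z times \<phi> of the resolvent, written in w = 1 / z; the value at 0 is
    the constant term of the series and removes the singularity at infinity.\<close>
  define H where "H w = (if w = 0 then \<phi> h else (1 / w) * \<phi> (resolvent (1 / w) h))" for w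
  have sums: "(\<lambda>n. fps_nth A n * w ^ n) sums H w" if "w \<in> ball 0 (1 / C)" for w
  proof (cases "w = 0")
    case True
    then show ?thesis
      using powser_sums_zero[of "fps_nth A"] by (simp add: A_def H_def)
  next
    case False
    then have "C < cmod (1 / w)" using that C by (simp add: norm_divide field_simps)
    from functional_resolvent_sums[OF fin C this h] show ?thesis
      using False by (simp add: A_def H_def)
  qed
  have "\<forall>\<^sub>F w in nhds 0. w \<in> ball 0 (1 / C)" using C by (intro eventually_nhds_in_open) auto
  then have "\<forall>\<^sub>F w in nhds 0. (\<lambda>n. fps_nth A n * w ^ n) sums H w"
    by eventually_elim (rule sums)
  then have HA: "H has_fps_expansion A" by (rule has_fps_expansionI)
  have "H holomorphic_on ball 0 (1 / C)"
    using sums by (intro power_series_holomorphic[where a="fps_nth A"]) auto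
  moreover have "H holomorphic_on (ball 0 (1 / s) - {0})"
  proof -
    let ?S = "{z. r < cmod z}"
    have S: "open ?S" "?S \<inter> spectrum M p T = {}"
      using r(2) by (auto simp: open_Collect_less not_less[symmetric] continuous_intros)
    have hol: "(\<lambda>z. \<phi> (resolvent z h)) holomorphic_on ?S"
      using functional_resolvent_derivative[OF S _ h]
      by (auto simp: holomorphic_on_open[OF S(1)])
    have "(\<lambda>w. (1 / w) * ((\<lambda>z. \<phi> (resolvent z h)) \<circ> (\<lambda>w. 1 / w)) w) holomorphic_on (ball 0 (1 / s) - {0})"
    proof (intro holomorphic_on_mult holomorphic_on_compose_gen[OF _ hol])
      show "(\<lambda>w. 1 / w) ` (ball 0 (1 / s) - {0}) \<subseteq> ?S"
      proof clarsimp
        fix w :: complex assume "cmod w < 1 / s" "w \<noteq> 0"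
        then have "s < 1 / cmod w" using s by (simp add: field_simps)
        then show "r < cmod (1 / w)" using s by (simp add: norm_divide)
      qed
    qed (auto intro!: holomorphic_intros)
    then show ?thesis
      by (rule holomorphic_transform) (simp add: H_def)
  qed
  \<comment> \<open>Both domains are open. The small disc, where the Neumann series represents H,
    supplies the origin; the resolvent supplies the rest of the large disc.\<close>
  ultimately have "H holomorphic_on (ball 0 (1 / C) \<union> (ball 0 (1 / s) - {0}))"
    by (intro holomorphic_on_Un) auto
  then have "H holomorphic_on eball 0 (ereal (1 / s))"
    by (rule holomorphic_on_subset) (use C in auto)
  then have "ereal (1 / s) \<le> fps_conv_radius (fps_expansion H 0)"
    by (rule conv_radius_fps_expansion)
  also have "fps_expansion H 0 = A" using HA by (rule fps_expansion_eqI)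
  finally have rad: "ereal (1 / s) \<le> conv_radius (fps_nth A)" by (simp add: fps_conv_radius_def)
  have "ereal (norm (complex_of_real (1 / \<rho>))) < ereal (1 / s)"
    using s by (simp add: norm_divide frac_less2)
  \<comment> \<open>Convergence at the single point 1 / \<rho> bounds the terms of the series, and
    this is the claimed growth of the coefficients.\<close>
  then have "summable (\<lambda>n. fps_nth A n * complex_of_real (1 / \<rho>) ^ n)"
    using rad by (intro summable_in_conv_radius) (rule less_le_trans)
  then have "(\<lambda>n. fps_nth A n * complex_of_real (1 / \<rho>) ^ n) \<longlonglongrightarrow> 0" by (rule summable_LIMSEQ_zero)
  then have "Bseq (\<lambda>n. fps_nth A n * complex_of_real (1 / \<rho>) ^ n)"
    by (intro convergent_imp_Bseq) (auto simp: convergent_def)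
  then obtain B where B: "0 < B" "\<And>n. norm (fps_nth A n * complex_of_real (1 / \<rho>) ^ n) \<le> B"
    by (auto elim: BseqE)
  show thesis
  proof (rule that[OF B(1)])
    fix n
    show "cmod (\<phi> ((T ^^ n) h)) \<le> B * \<rho> ^ n"
      using B(2)[of n] s by (simp add: A_def norm_mult norm_power norm_divide power_divide field_simps)
  qed
qed

end

end

subsection \<open>Integral operators with nonnegative kernel\<close>

lemma Lp_space_of_real_iff:
  "(\<lambda>x. complex_of_real (h x)) \<in> Lp_space M p \<longleftrightarrow> h \<in> Lp_space M p"
proof -
  have "(\<lambda>x. complex_of_real (h x)) \<in> borel_measurable M \<longleftrightarrow> h \<in> borel_measurable M"
  proof
    assume "(\<lambda>x. complex_of_real (h x)) \<in> borel_measurable M"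
    from measurable_compose[OF this borel_measurable_Re] show "h \<in> borel_measurable M" by simp
  qed simp
  then show ?thesis by (simp add: Lp_space_def)
qed

lemma Lp_norm_of_real: "Lp_norm M p (\<lambda>x. complex_of_real (h x)) = Lp_norm M p h"
  by (simp add: Lp_norm_def)

lemma finite_measure_if_one_in_Lp:
  assumes "p \<noteq> \<infinity>" "(\<lambda>_. 1 :: real) \<in> Lp_space M p"
  shows "finite_measure M"
  using assms by (intro finite_measureI) (auto simp: Lp_space_def)

section \<open>The Hilbert space case and normal operators\<close>

lemma powr_two: "0 \<le> t \<Longrightarrow> t powr 2 = (t :: real)\<^sup>2"
  by (cases "t = 0") auto

lemma L2_space_iff:
  "h \<in> Lp_space M 2 \<longleftrightarrow> h \<in> borel_measurable M \<and> (\<integral>\<^sup>+ x. ennreal ((norm (h x))\<^sup>2) \<partial>M) < \<infinity>"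
  by (simp add: Lp_space_def powr_two)

lemma L2_norm_eq: "Lp_norm M 2 h = sqrt (enn2real (\<integral>\<^sup>+ x. ennreal ((norm (h x))\<^sup>2) \<partial>M))"
  by (simp add: Lp_norm_def powr_two powr_half_sqrt)

lemma borel_measurable_cnj [measurable (raw)]:
  "u \<in> borel_measurable M \<Longrightarrow> (\<lambda>x. cnj (u x)) \<in> borel_measurable M"
  by (rule borel_measurable_continuous_on[of cnj]) (intro continuous_intros)

lemma L2_integrable_mult_cnj:
  assumes u: "u \<in> Lp_space M 2" and v: "v \<in> Lp_space M 2"
  shows "integrable M (\<lambda>x. u x * cnj (v x))"
proof -
  have [measurable]: "u \<in> borel_measurable M" "v \<in> borel_measurable M"
    using u v by (auto simp: L2_space_iff)
  have "integrable M (\<lambda>x. (cmod (u x))\<^sup>2)" "integrable M (\<lambda>x. (cmod (v x))\<^sup>2)"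
    using u v by (auto simp: L2_space_iff intro!: integrableI_nonneg)
  then have "integrable M (\<lambda>x. (cmod (u x))\<^sup>2 + (cmod (v x))\<^sup>2)" by (rule Bochner_Integration.integrable_add)
  then show ?thesis
  proof (rule Bochner_Integration.integrable_bound)
    have "a * b \<le> a\<^sup>2 + b\<^sup>2" if "0 \<le> a" "0 \<le> b" for a b :: real
      using sum_squares_bound[of a b] mult_nonneg_nonneg[OF that] by linarith
    then show "AE x in M. norm (u x * cnj (v x)) \<le> norm ((cmod (u x))\<^sup>2 + (cmod (v x))\<^sup>2)"
      by (intro AE_I2) (simp add: norm_mult)
  qed measurable
qed

text \<open>
  An eigenvector of a normal operator is an eigenvector of the adjoint:
  expanding \<open>\<parallel>S f - r f\<parallel>\<^sup>2\<close> and using \<open>T S = S T\<close> makes all terms cancel.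
\<close>

lemma normal_adjoint_eigenvector:
  fixes r :: real and T S :: "('a \<Rightarrow> complex) \<Rightarrow> 'a \<Rightarrow> complex" and f :: "'a \<Rightarrow> complex"
  assumes T: "bounded_operator M 2 T" and S: "is_adjoint M T S"
    and comm: "\<And>h. h \<in> Lp_space M 2 \<Longrightarrow> AE x in M. T (S h) x = S (T h) x"
    and f: "f \<in> Lp_space M 2" and eigen: "AE x in M. T f x = r * f x"
  shows "AE x in M. S f x = r * f x"
proof -
  interpret T: Lp_operator M 2 T by unfold_locales (use T in auto)
  interpret S: Lp_operator M 2 S by unfold_locales (use S in \<open>auto simp: is_adjoint_def\<close>)
  define ip where "ip u v = (\<integral>x. u x * cnj (v x) \<partial>M)" for u v :: "'a \<Rightarrow> complex"
  have adj: "ip (T u) v = ip u (S v)" if "u \<in> Lp_space M 2" "v \<in> Lp_space M 2" for u v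
    using S that by (auto simp: is_adjoint_def ip_def)
  have ip_cong: "ip u v = ip u' v" if "AE x in M. u x = u' x" "u \<in> Lp_space M 2" "u' \<in> Lp_space M 2" "v \<in> Lp_space M 2" for u u' v
  proof -
    have [measurable]: "u \<in> borel_measurable M" "u' \<in> borel_measurable M" "v \<in> borel_measurable M"
      using that by (auto intro: Lp_space_measurable)
    show ?thesis unfolding ip_def
      by (intro integral_cong_AE) (use that(1) in \<open>auto elim!: eventually_mono\<close>)
  qed
  have ip_scale: "ip (\<lambda>x. r * u x) v = r * ip u v" for u v :: "'a \<Rightarrow> complex"
    by (simp add: ip_def mult.assoc)
  have Sf: "S f \<in> Lp_space M 2" and Tf: "T f \<in> Lp_space M 2" using f by (auto intro: S.closed T.closed)
  have rf: "(\<lambda>x. r * f x) \<in> Lp_space M 2" and rSf: "(\<lambda>x. r * S f x) \<in> Lp_space M 2"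
    using f Sf by (auto intro!: Lp_space_cmult)
  have "AE x in M. S (T f) x = S (\<lambda>x. r * f x) x" by (intro S.cong_AE Tf rf eigen)
  moreover have "AE x in M. S (\<lambda>x. r * f x) x = r * S f x"
    using S.lincomb_AE[OF f f, of r 0] by simp
  \<comment> \<open>Commutation puts S f into the eigenspace of T for r, so the adjoint relation can
    be used on S f as well as on f. Since r is real, no conjugates appear.\<close>
  ultimately have TSf: "AE x in M. T (S f) x = r * S f x"
    using comm[OF f] by eventually_elim simp
  have "ip (S f) (S f) = ip (T (S f)) f" using adj[OF Sf f] by simp
  also have "\<dots> = ip (\<lambda>x. r * S f x) f" by (intro ip_cong TSf T.closed Sf rSf f)
  finally have 1: "ip (S f) (S f) = r * ip (S f) f" by (simp add: ip_scale)
  have "ip f (S f) = ip (T f) f" using adj[OF f f] by simp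
  also have "\<dots> = ip (\<lambda>x. r * f x) f" by (intro ip_cong eigen Tf rf f)
  finally have 2: "ip f (S f) = r * ip f f" by (simp add: ip_scale)
  let ?d = "\<lambda>x. S f x - r * f x"
  have d: "?d \<in> Lp_space M 2" using Sf rf by (intro Lp_space_diff) auto
  have "ip ?d ?d = (\<integral>x. S f x * cnj (S f x) - r * (S f x * cnj (f x)) - r * (f x * cnj (S f x)) + r * r * (f x * cnj (f x)) \<partial>M)"
    unfolding ip_def by (intro Bochner_Integration.integral_cong) (auto simp: algebra_simps)
  also have "\<dots> = ip (S f) (S f) - r * ip (S f) f - r * ip f (S f) + r * r * ip f f"
    using L2_integrable_mult_cnj[OF Sf Sf] L2_integrable_mult_cnj[OF Sf f]
      L2_integrable_mult_cnj[OF f Sf] L2_integrable_mult_cnj[OF f f]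
    unfolding ip_def by simp
  also have "\<dots> = 0" by (simp add: 1 2)
  finally have "(\<integral>x. ?d x * cnj (?d x) \<partial>M) = 0" by (simp add: ip_def)
  moreover have "?d x * cnj (?d x) = complex_of_real ((cmod (?d x))\<^sup>2)" for x
    by (simp only: complex_norm_square)
  ultimately have "complex_of_real (\<integral>x. (cmod (?d x))\<^sup>2 \<partial>M) = 0" by (simp only: integral_complex_of_real)
  then have zero: "(\<integral>x. (cmod (?d x))\<^sup>2 \<partial>M) = 0" by simp
  have "integrable M (\<lambda>x. (cmod (?d x))\<^sup>2)"
    using d by (auto simp: L2_space_iff intro!: integrableI_nonneg)
  then have "AE x in M. (cmod (?d x))\<^sup>2 = 0"
    using integral_nonneg_eq_0_iff_AE[of M "\<lambda>x. (cmod (?d x))\<^sup>2"] zero by simp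
  then show ?thesis by eventually_elim simp
qed

section \<open>Order properties of kernel operators\<close>

locale Lp_integral_operator =
  fixes M :: "'a measure" and p :: ennreal and k :: "'a \<Rightarrow> 'a \<Rightarrow> real"
  assumes exponent: "1 \<le> p"
    and sigma_finite_M: "sigma_finite_measure M"
    and k_nonneg: "\<And>x y. x \<in> space M \<Longrightarrow> y \<in> space M \<Longrightarrow> 0 \<le> k x y"
    and bounded_integral: "bounded_integral_operator M p k"
begin

sublocale Lp_operator M p "integral_op M k"
  using exponent bounded_integral by unfold_locales (auto simp: bounded_integral_operator_def)

lemma k_measurable [measurable]: "(\<lambda>(x, y). k x y) \<in> borel_measurable (M \<Otimes>\<^sub>M M)"
  using bounded_integral by (simp add: bounded_integral_operator_def)

lemma k_section_measurable [measurable]: "x \<in> space M \<Longrightarrow> k x \<in> borel_measurable M"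
  using measurable_Pair2[OF k_measurable] by simp

text \<open>Connects real functions, for which order arguments make sense, with the complex operator
  to which spectrum and norm bounds refer.\<close>

lemma integral_op_of_real:
  "integral_op M k (\<lambda>y. complex_of_real (h y)) = (\<lambda>x. complex_of_real (integral_op M k h x))"
  by (simp add: integral_op_def fun_eq_iff scaleR_conv_of_real flip: of_real_mult)

lemma funpow_of_real:
  "(integral_op M k ^^ n) (\<lambda>y. complex_of_real (h y)) = (\<lambda>x. complex_of_real ((integral_op M k ^^ n) h x))"
  by (induction n) (simp_all add: integral_op_of_real)

lemma real_closed:
  fixes h :: "'a \<Rightarrow> real"
  shows "h \<in> Lp_space M p \<Longrightarrow> integral_op M k h \<in> Lp_space M p"
  using closed[of "\<lambda>y. complex_of_real (h y)"] unfolding integral_op_of_real Lp_space_of_real_iff .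

lemma real_funpow_closed:
  fixes h :: "'a \<Rightarrow> real"
  shows "h \<in> Lp_space M p \<Longrightarrow> (integral_op M k ^^ n) h \<in> Lp_space M p"
  by (induction n) (auto intro: real_closed)

lemma integrable_section:
  "h \<in> Lp_space M p \<Longrightarrow> AE x in M. integrable M (\<lambda>y. k x y *\<^sub>R (h y :: complex))"
  using bounded_integral by (simp add: bounded_integral_operator_def)

lemma real_integrable_section:
  assumes "h \<in> Lp_space M p"
  shows "AE x in M. integrable M (\<lambda>y. k x y * h y)"
proof -
  have "AE x in M. integrable M (\<lambda>y. k x y *\<^sub>R complex_of_real (h y))"
    using assms by (intro integrable_section) (simp add: Lp_space_of_real_iff)
  then show ?thesis
  proof eventually_elim
    case (elim x)
    have "(\<lambda>y. k x y *\<^sub>R complex_of_real (h y)) = (\<lambda>y. complex_of_real (k x y * h y))"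
      by (simp add: scaleR_conv_of_real)
    then show ?case using elim by (simp only: complex_of_real_integrable_eq)
  qed
qed

text \<open>Both section integrals converge for almost every x, so the default value 0 of a
  divergent integral cannot spoil the comparison.\<close>

lemma mono_AE:
  fixes u v :: "'a \<Rightarrow> real"
  assumes "u \<in> Lp_space M p" "v \<in> Lp_space M p" and le: "AE x in M. u x \<le> v x"
  shows "AE x in M. integral_op M k u x \<le> integral_op M k v x"
  using real_integrable_section[OF assms(1)] real_integrable_section[OF assms(2)] AE_space
proof eventually_elim
  case (elim x)
  show ?case
    unfolding integral_op_def real_scaleR_def
  proof (rule integral_mono_AE)
    show "AE y in M. k x y * u y \<le> k x y * v y"
      using le AE_space by eventually_elim (auto intro: mult_left_mono k_nonneg elim(3))
  qed (use elim in auto)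
qed

lemma funpow_ge_eigenfunction:
  fixes f h :: "'a \<Rightarrow> real"
  assumes f: "f \<in> Lp_space M p" and h: "h \<in> Lp_space M p" and r: "0 \<le> r"
    and eigen: "AE x in M. integral_op M k f x = r * f x"
    and le: "AE x in M. c * f x \<le> h x"
  shows "AE x in M. c * r ^ n * f x \<le> (integral_op M k ^^ n) h x"
proof (induction n)
  case (Suc n)
  have le: "AE x in M. integral_op M k (\<lambda>x. c * r ^ n * f x) x \<le> integral_op M k ((integral_op M k ^^ n) h) x"
    using Suc by (intro mono_AE real_funpow_closed h Lp_space_cmult exponent f)
  have eq: "integral_op M k (\<lambda>x. c * r ^ n * f x) x = c * r ^ n * integral_op M k f x" for x
    by (simp add: integral_op_def mult.left_commute[of "k x _"])
  show ?case using le eigen unfolding eq by eventually_elim (simp add: ac_simps)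
qed (use le in simp)

text \<open>Serves the degenerate case r = 0: a nonnegative section integrated against f > 0 can
  give 0 only if the section vanishes almost everywhere, and then the operator kills every
  function.\<close>

lemma integral_op_zero:
  fixes f h :: "'a \<Rightarrow> real"
  assumes f: "f \<in> Lp_space M p" and pos: "AE x in M. 0 < f x"
    and eigen: "AE x in M. integral_op M k f x = 0"
  shows "AE x in M. integral_op M k h x = 0"
  using real_integrable_section[OF f] eigen AE_space
proof eventually_elim
  case (elim x)
  have "AE y in M. 0 \<le> k x y * f y"
    using pos AE_space by eventually_elim (simp add: k_nonneg elim(3))
  then have "AE y in M. k x y * f y = 0"
    using integral_nonneg_eq_0_iff_AE[of M "\<lambda>y. k x y * f y"] elim by (simp add: integral_op_def)
  then have "AE y in M. k x y *\<^sub>R h y = 0"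
    using pos by eventually_elim auto
  then show ?case by (simp add: integral_op_def integral_eq_zero_AE)
qed

section \<open>The norm bound for normal operators\<close>

text \<open>Split k |h| as sqrt (k f) times sqrt (k / f) |h| and apply Cauchy-Schwarz in y. The
  first factor integrates to T f = r f, and after exchanging the integrals the transposed eigenvalue
  relation gives a second r f(y) that cancels the weight 1 / f(y). Each relation contributes one
  factor r to the bound r^2 for the squared norm.\<close>

lemma Schur_test:
  fixes f :: "'a \<Rightarrow> real" and h :: "'a \<Rightarrow> complex"
  assumes p2: "p = 2" and r: "0 \<le> r" and f: "f \<in> Lp_space M p" and pos: "AE x in M. 0 < f x"
    and eigen: "AE x in M. integral_op M k f x = r * f x"
    and adjoint: "AE y in M. (\<integral>\<^sup>+ x. ennreal (k x y * f x) \<partial>M) = ennreal (r * f y)"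
    and h: "h \<in> Lp_space M p"
  shows "Lp_norm M p (integral_op M k h) \<le> r * Lp_norm M p h"
proof -
  interpret sigma_finite_measure M by (rule sigma_finite_M)
  interpret pair_sigma_finite M M ..
  have [measurable]: "f \<in> borel_measurable M" "h \<in> borel_measurable M"
    using f h by (auto intro: Lp_space_measurable)
  let ?W = "\<lambda>x. \<integral>\<^sup>+ y. ennreal (k x y * (cmod (h y))\<^sup>2 / f y) \<partial>M"
  have "AE x in M. ennreal ((cmod (integral_op M k h x))\<^sup>2) \<le> ennreal (r * f x) * ?W x"
    using eigen real_integrable_section[OF f] integrable_section[OF h] pos AE_space
  proof eventually_elim
    case (elim x)
    have [measurable]: "k x \<in> borel_measurable M" using elim by simp
    let ?F = "\<lambda>y. ennreal (sqrt (k x y * f y))" and ?G = "\<lambda>y. ennreal (sqrt (k x y / f y) * cmod (h y))"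
    have "ennreal (cmod (integral_op M k h x)) \<le> (\<integral>\<^sup>+ y. ennreal (norm (k x y *\<^sub>R h y)) \<partial>M)"
      unfolding integral_op_def using elim by (intro integral_norm_bound_ennreal)
    also have "\<dots> = (\<integral>\<^sup>+ y. ?F y * ?G y \<partial>M)"
      using pos AE_space[of M]
    proof (intro nn_integral_cong_AE, eventually_elim)
      case E: (elim y)
      have k: "0 \<le> k x y" using elim E by (intro k_nonneg)
      have eq: "sqrt (k x y * f y) * (sqrt (k x y / f y) * cmod (h y)) = k x y * cmod (h y)"
        using k E by (simp add: real_sqrt_mult real_sqrt_divide)
      have n: "norm (k x y *\<^sub>R h y) = k x y * cmod (h y)" using k by simp
      show ?case unfolding n eq[symmetric] using k E by (intro ennreal_mult) auto
    qed
    finally have "(ennreal (cmod (integral_op M k h x)))\<^sup>2 \<le> (\<integral>\<^sup>+ y. ?F y * ?G y \<partial>M)\<^sup>2"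
      by (rule power_mono) simp
    also have "\<dots> \<le> (\<integral>\<^sup>+ y. (?F y)\<^sup>2 \<partial>M) * (\<integral>\<^sup>+ y. (?G y)\<^sup>2 \<partial>M)"
      by (intro Cauchy_Schwarz_nn_integral) auto
    also have "(\<integral>\<^sup>+ y. (?F y)\<^sup>2 \<partial>M) = (\<integral>\<^sup>+ y. ennreal (k x y * f y) \<partial>M)"
      using pos AE_space[of M]
    proof (intro nn_integral_cong_AE, eventually_elim)
      case E: (elim y)
      have "0 \<le> k x y" using elim E by (intro k_nonneg)
      then show ?case using E by (simp add: ennreal_power)
    qed
    also have "\<dots> = ennreal (integral_op M k f x)"
      unfolding integral_op_def real_scaleR_def
    proof (rule nn_integral_eq_integral)
      show "AE y in M. 0 \<le> k x y * f y"
        using pos AE_space by eventually_elim (simp add: k_nonneg elim)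
    qed (use elim in simp)
    also have "(\<integral>\<^sup>+ y. (?G y)\<^sup>2 \<partial>M) = ?W x"
      using pos AE_space[of M]
    proof (intro nn_integral_cong_AE, eventually_elim)
      case E: (elim y)
      have "0 \<le> k x y" using elim E by (intro k_nonneg)
      then show ?case using E by (simp add: ennreal_power power_mult_distrib)
    qed
    finally show ?case using elim by (simp add: ennreal_power)
  qed
  then have "(\<integral>\<^sup>+ x. ennreal ((cmod (integral_op M k h x))\<^sup>2) \<partial>M) \<le> (\<integral>\<^sup>+ x. ennreal (r * f x) * ?W x \<partial>M)"
    by (rule nn_integral_mono_AE)
  also have "\<dots> = (\<integral>\<^sup>+ x. \<integral>\<^sup>+ y. ennreal (r * f x) * ennreal (k x y * (cmod (h y))\<^sup>2 / f y) \<partial>M \<partial>M)"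
    by (intro nn_integral_cong nn_integral_cmult[symmetric]) simp
  also have "\<dots> = (\<integral>\<^sup>+ y. \<integral>\<^sup>+ x. ennreal (r * f x) * ennreal (k x y * (cmod (h y))\<^sup>2 / f y) \<partial>M \<partial>M)"
    by (rule Fubini'[symmetric]) measurable
  also have "\<dots> = (\<integral>\<^sup>+ y. ennreal (r\<^sup>2) * ennreal ((cmod (h y))\<^sup>2) \<partial>M)"
    using adjoint pos AE_space[of M]
  proof (intro nn_integral_cong_AE, eventually_elim)
    case (elim y)
    have [measurable]: "(\<lambda>x. k x y) \<in> borel_measurable M"
      using measurable_Pair1[OF k_measurable \<open>y \<in> space M\<close>] by simp
    have "(\<integral>\<^sup>+ x. ennreal (r * f x) * ennreal (k x y * (cmod (h y))\<^sup>2 / f y) \<partial>M)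
        = (\<integral>\<^sup>+ x. ennreal (r * (cmod (h y))\<^sup>2 / f y) * ennreal (k x y * f x) \<partial>M)"
      using pos AE_space[of M]
    proof (intro nn_integral_cong_AE, eventually_elim)
      case E: (elim x)
      have "0 \<le> k x y" using elim E by (intro k_nonneg)
      then show ?case using E elim r by (simp add: field_simps flip: ennreal_mult)
    qed
    also have "\<dots> = ennreal (r * (cmod (h y))\<^sup>2 / f y) * ennreal (r * f y)"
      by (subst nn_integral_cmult) (simp_all add: elim)
    also have "\<dots> = ennreal (r\<^sup>2) * ennreal ((cmod (h y))\<^sup>2)"
      using elim r by (simp add: power2_eq_square field_simps flip: ennreal_mult)
    finally show ?case .
  qed
  also have "\<dots> = ennreal (r\<^sup>2) * (\<integral>\<^sup>+ y. ennreal ((cmod (h y))\<^sup>2) \<partial>M)"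
    by (rule nn_integral_cmult) simp
  finally have le: "(\<integral>\<^sup>+ x. ennreal ((cmod (integral_op M k h x))\<^sup>2) \<partial>M)
      \<le> ennreal (r\<^sup>2) * (\<integral>\<^sup>+ y. ennreal ((cmod (h y))\<^sup>2) \<partial>M)" .
  have "(\<integral>\<^sup>+ y. ennreal ((cmod (h y))\<^sup>2) \<partial>M) < top" using h p2 by (simp add: L2_space_iff)
  \<comment> \<open>Finiteness of the right-hand side is essential here: \<open>enn2real\<close> is
    monotone only below \<infinity>.\<close>
  then have "enn2real (\<integral>\<^sup>+ x. ennreal ((cmod (integral_op M k h x))\<^sup>2) \<partial>M)
      \<le> r\<^sup>2 * enn2real (\<integral>\<^sup>+ y. ennreal ((cmod (h y))\<^sup>2) \<partial>M)"
    using enn2real_mono[OF le] by (simp add: enn2real_mult ennreal_mult_less_top)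
  then have "sqrt (enn2real (\<integral>\<^sup>+ x. ennreal ((cmod (integral_op M k h x))\<^sup>2) \<partial>M))
      \<le> sqrt (r\<^sup>2 * enn2real (\<integral>\<^sup>+ y. ennreal ((cmod (h y))\<^sup>2) \<partial>M))"
    by (rule real_sqrt_le_mono)
  then show ?thesis using r by (simp add: p2 L2_norm_eq real_sqrt_mult)
qed

text \<open>The adjoint is given abstractly, so it is tested on indicator functions, which are
  square integrable because the measure is finite. The adjoint relation and an exchange of integrals
  show that both sides, taken as densities, give every measurable set the same mass; hence they
  agree almost everywhere. Nonnegative integrals are used since the left-hand side is not known to
  be finite beforehand.\<close>

lemma normal_transpose_eigenfunction:
  fixes f :: "'a \<Rightarrow> real"
  assumes p2: "p = 2" and fin: "finite_measure M" and normal: "normal_operator M (integral_op M k)"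
    and r: "0 \<le> r" and f: "f \<in> Lp_space M p" and pos: "AE x in M. 0 < f x"
    and eigen: "AE x in M. integral_op M k f x = r * f x"
  shows "AE y in M. (\<integral>\<^sup>+ x. ennreal (k x y * f x) \<partial>M) = ennreal (r * f y)"
proof -
  interpret finite_measure M by (rule fin)
  interpret pair_sigma_finite M M ..
  have [measurable]: "f \<in> borel_measurable M" using f by (rule Lp_space_measurable)
  let ?T = "integral_op M k"
  let ?f = "\<lambda>x. complex_of_real (f x)"
  have fc: "?f \<in> Lp_space M 2" using f p2 by (simp add: Lp_space_of_real_iff)
  obtain S where S: "is_adjoint M ?T S"
    and comm: "\<And>h. h \<in> Lp_space M 2 \<Longrightarrow> AE x in M. ?T (S h) x = S (?T h) x"
    using normal by (auto simp: normal_operator_def)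
  have adj: "(\<integral>x. ?T u x * cnj (v x) \<partial>M) = (\<integral>x. u x * cnj (S v x) \<partial>M)"
    if "u \<in> Lp_space M 2" "v \<in> Lp_space M 2" for u v
    using S that by (simp add: is_adjoint_def)
  have "AE x in M. S ?f x = r * ?f x"
  proof (rule normal_adjoint_eigenvector[OF _ S comm fc])
    show "bounded_operator M 2 ?T" using bounded p2 by simp
    show "AE x in M. ?T ?f x = r * ?f x" using eigen by (auto simp: integral_op_of_real elim!: eventually_mono)
  qed
  note Sf = this
  have [measurable]: "S ?f \<in> borel_measurable M"
    using S fc by (auto simp: is_adjoint_def bounded_operator_def intro: Lp_space_measurable)
  show ?thesis
  proof (rule sigma_finite_measure.density_unique2[OF sigma_finite_M])
    fix B assume B[measurable]: "B \<in> sets M"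
    let ?b = "indicator B :: 'a \<Rightarrow> real"
    have "(\<integral>\<^sup>+ x. ennreal ((norm (?b x))\<^sup>2) \<partial>M) = (\<integral>\<^sup>+ x. indicator B x \<partial>M)"
      by (intro nn_integral_cong) (simp split: split_indicator)
    also have "\<dots> < \<infinity>" by (simp add: emeasure_finite less_top[symmetric])
    finally have b: "?b \<in> Lp_space M p" by (simp add: p2 L2_space_iff)
    then have bc: "(\<lambda>x. complex_of_real (?b x)) \<in> Lp_space M 2" using p2 by (simp add: Lp_space_of_real_iff)
    have Tb: "?T ?b \<in> Lp_space M p" using b by (rule real_closed)
    then have [measurable]: "?T ?b \<in> borel_measurable M" by (rule Lp_space_measurable)
    have Tbc: "(\<lambda>x. complex_of_real (?T ?b x)) \<in> Lp_space M 2" using Tb p2 by (simp add: Lp_space_of_real_iff)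
    have "(\<integral>x. ?T (\<lambda>x. complex_of_real (?b x)) x * cnj (?f x) \<partial>M) = (\<integral>x. complex_of_real (?b x) * cnj (S ?f x) \<partial>M)"
      by (rule adj[OF bc fc])
    also have "\<dots> = (\<integral>x. complex_of_real (?b x * (r * f x)) \<partial>M)"
      by (intro integral_cong_AE) (use Sf in \<open>auto elim!: eventually_mono\<close>)
    finally have "complex_of_real (\<integral>x. ?T ?b x * f x \<partial>M) = complex_of_real (\<integral>x. ?b x * (r * f x) \<partial>M)"
      unfolding integral_op_of_real integral_complex_of_real[symmetric] by simp
    then have eq: "(\<integral>x. ?T ?b x * f x \<partial>M) = (\<integral>x. ?b x * (r * f x) \<partial>M)" by simp
    have "integrable M (\<lambda>x. complex_of_real (?T ?b x * f x))"
      using L2_integrable_mult_cnj[OF Tbc fc] by simp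
    then have int1: "integrable M (\<lambda>x. ?T ?b x * f x)" by (simp only: complex_of_real_integrable_eq)
    have "integrable M (\<lambda>x. complex_of_real (?b x * f x))"
      using L2_integrable_mult_cnj[OF bc fc] by simp
    then have "integrable M (\<lambda>x. ?b x * f x)" by (simp only: complex_of_real_integrable_eq)
    then have int2: "integrable M (\<lambda>x. ?b x * (r * f x))"
      using integrable_mult_right[of r M "\<lambda>x. ?b x * f x"] by (simp add: mult.left_commute)
    have nn1: "AE x in M. 0 \<le> ?T ?b x * f x"
      using pos AE_space
    proof eventually_elim
      case (elim x)
      have "0 \<le> ?T ?b x" unfolding integral_op_def
        using elim by (intro integral_nonneg_AE AE_I2) (auto intro!: mult_nonneg_nonneg k_nonneg)
      then show ?case using elim by simp
    qed
    have nn2: "AE x in M. 0 \<le> ?b x * (r * f x)"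
      using pos by eventually_elim (use r in auto)
    have "(\<integral>\<^sup>+ y. (\<integral>\<^sup>+ x. ennreal (k x y * f x) \<partial>M) * indicator B y \<partial>M)
        = (\<integral>\<^sup>+ y. \<integral>\<^sup>+ x. ennreal (k x y * f x) * indicator B y \<partial>M \<partial>M)"
      by (intro nn_integral_cong nn_integral_multc[symmetric]) simp
    also have "\<dots> = (\<integral>\<^sup>+ x. \<integral>\<^sup>+ y. ennreal (k x y * f x) * indicator B y \<partial>M \<partial>M)"
      by (rule Fubini') measurable
    also have "\<dots> = (\<integral>\<^sup>+ x. ennreal (?T ?b x * f x) \<partial>M)"
      using pos real_integrable_section[OF b] AE_space[of M]
    proof (intro nn_integral_cong_AE, eventually_elim)
      case (elim x)
      have nn: "0 \<le> k x y * ?b y" if "y \<in> space M" for y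
        using elim that by (intro mult_nonneg_nonneg k_nonneg) auto
      have "(\<integral>\<^sup>+ y. ennreal (k x y * f x) * indicator B y \<partial>M) = (\<integral>\<^sup>+ y. ennreal (f x) * ennreal (k x y * ?b y) \<partial>M)"
        using elim by (intro nn_integral_cong) (auto simp: mult.commute k_nonneg split: split_indicator simp flip: ennreal_mult)
      also have "\<dots> = ennreal (f x) * (\<integral>\<^sup>+ y. ennreal (k x y * ?b y) \<partial>M)"
        using elim by (intro nn_integral_cmult) simp
      also have "(\<integral>\<^sup>+ y. ennreal (k x y * ?b y) \<partial>M) = ennreal (?T ?b x)"
        unfolding integral_op_def real_scaleR_def using elim nn by (intro nn_integral_eq_integral AE_I2)
      also have "ennreal (f x) * ennreal (?T ?b x) = ennreal (?T ?b x * f x)"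
        using elim by (subst mult.commute) (simp add: ennreal_mult'')
      finally show ?case .
    qed
    also have "\<dots> = ennreal (\<integral>x. ?b x * (r * f x) \<partial>M)"
      unfolding eq[symmetric] using int1 nn1 by (rule nn_integral_eq_integral)
    also have "\<dots> = (\<integral>\<^sup>+ x. ennreal (?b x * (r * f x)) \<partial>M)"
      using int2 nn2 by (rule nn_integral_eq_integral[symmetric])
    also have "\<dots> = (\<integral>\<^sup>+ x. ennreal (r * f x) * indicator B x \<partial>M)"
      by (intro nn_integral_cong) (simp split: split_indicator)
    finally show "(\<integral>\<^sup>+ y. (\<integral>\<^sup>+ x. ennreal (k x y * f x) \<partial>M) * indicator B y \<partial>M)
        = (\<integral>\<^sup>+ x. ennreal (r * f x) * indicator B x \<partial>M)" .
  qed measurable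
qed

end

subsection \<open>Growth of the iterates\<close>

text \<open>The hypotheses are asymmetric like the estimates they serve: the lower bound loses a
  constant factor, the upper bound an arbitrarily small exponential rate. Taking half the slope
  leaves the other half to absorb K for large n.\<close>

lemma smallo_real_if_eventually_between:
  fixes e :: "nat \<Rightarrow> real"
  assumes lower: "\<And>n. - c \<le> e n"
    and upper: "\<And>\<epsilon>. 0 < \<epsilon> \<Longrightarrow> \<exists>K. \<forall>n. e n \<le> K + \<epsilon> * real n"
  shows "e \<in> o(\<lambda>n. real n)"
proof (rule landau_o.smallI)
  fix \<epsilon> :: real assume \<epsilon>: "0 < \<epsilon>"
  obtain K where K: "\<And>n. e n \<le> K + \<epsilon> / 2 * real n" using upper[of "\<epsilon> / 2"] \<epsilon> by auto
  have "\<forall>\<^sub>F n in sequentially. (2 * \<bar>K\<bar> + \<bar>c\<bar>) / \<epsilon> \<le> real n"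
    using filterlim_real_sequentially by (simp add: filterlim_at_top)
  then show "\<forall>\<^sub>F n in sequentially. norm (e n) \<le> \<epsilon> * norm (real n)"
  proof eventually_elim
    case (elim n)
    then have "2 * \<bar>K\<bar> + \<bar>c\<bar> \<le> \<epsilon> * real n" using \<epsilon> by (simp add: field_simps)
    then show ?case using K[of n] lower[of n] by simp
  qed
qed

text \<open>The form of the conclusion handles two degenerate bases. For r = 1 every
  \<open>r powr\<close> is 1, so the exponent carries no information and the claim is read as exp of
  \<open>o(N)\<close>. For r = 0, \<open>powr\<close> gives 0 for all exponents, whereas the
  integral for N = 0 is the positive mass of \<mu>; hence N \<ge> 1. In the two-sided bound
  \<open>0 ^ 0 = 1\<close>, so N = 0 may stay. A zero \<mu> is excluded because all integrals would
  vanish.\<close>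

theorem lemma3:
  fixes \<nu> \<mu> :: "'a measure"
    and p q :: ennreal
    and k :: "'a \<Rightarrow> 'a \<Rightarrow> real"
    and f g :: "'a \<Rightarrow> real"
    and r :: real
  assumes sigma_finite: "sigma_finite_measure \<nu>"
    and p: "1 \<le> p"
    and k_nonneg: "\<And>x y. x \<in> space \<nu> \<Longrightarrow> y \<in> space \<nu> \<Longrightarrow> 0 \<le> k x y"
    and T: "bounded_integral_operator \<nu> p k"
    and a: "\<exists>n\<ge>1. compact_operator \<nu> p (integral_op \<nu> k ^^ n)"
    and b: "\<And>B. B \<in> sets \<nu> \<Longrightarrow> 0 < emeasure \<nu> B \<Longrightarrow> 0 < emeasure \<nu> (space \<nu> - B) \<Longrightarrow>
      0 < (\<integral>\<^sup>+ y \<in> space \<nu> - B. (\<integral>\<^sup>+ x \<in> B. ennreal (k x y) \<partial>\<nu>) \<partial>\<nu>)"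
    and r: "r = spectral_radius \<nu> p (integral_op \<nu> k)"
    and f_Lp: "f \<in> Lp_space \<nu> p"
    and f_norm: "Lp_norm \<nu> p f = 1"
    and f_pos: "AE x in \<nu>. 0 < f x"
    and f_eigen: "AE x in \<nu>. integral_op \<nu> k f x = r * f x"
    and one_Lp: "(\<lambda>_. 1 :: real) \<in> Lp_space \<nu> p"
    and f_bounded: "f \<in> Lp_space \<nu> \<infinity>"
    and q: "1 / p + 1 / q = 1"
    and g_Lq: "g \<in> Lp_space \<nu> q"
    and g_nonneg: "AE x in \<nu>. 0 \<le> g x"
    and \<mu>: "\<mu> = density \<nu> (\<lambda>x. ennreal (g x))"
    and \<mu>_finite: "finite_measure \<mu>"
    and \<mu>_nonzero: "emeasure \<mu> (space \<mu>) \<noteq> 0"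
  shows "(r \<noteq> 1 \<longrightarrow> (\<exists>e. e \<in> o(\<lambda>N. real N) \<and>
            (\<forall>N\<ge>1. (\<integral>x. (integral_op \<nu> k ^^ N) (\<lambda>_. 1 :: real) x \<partial>\<mu>) = r powr (real N + e N)))) \<and>
         (r = 1 \<longrightarrow> (\<exists>e. e \<in> o(\<lambda>N. real N) \<and>
            (\<forall>N\<ge>1. (\<integral>x. (integral_op \<nu> k ^^ N) (\<lambda>_. 1 :: real) x \<partial>\<mu>) = exp (e N)))) \<and>
         (p = 2 \<and> normal_operator \<nu> (integral_op \<nu> k) \<longrightarrow>
            (\<exists>c>0. \<exists>C>0. \<forall>N.
               c * r ^ N \<le> (\<integral>x. (integral_op \<nu> k ^^ N) (\<lambda>_. 1 :: real) x \<partial>\<mu>) \<and>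
               (\<integral>x. (integral_op \<nu> k ^^ N) (\<lambda>_. 1 :: real) x \<partial>\<mu>) \<le> C * r ^ N))"
proof -
  let ?T = "integral_op \<nu> k"
  interpret Lp_integral_operator \<nu> p k
    using p sigma_finite k_nonneg T by (rule Lp_integral_operator.intro)
  have fin: "p \<noteq> \<infinity> \<Longrightarrow> finite_measure \<nu>"
    using one_Lp by (rule finite_measure_if_one_in_Lp[rotated])
  have [measurable]: "f \<in> borel_measurable \<nu>" "g \<in> borel_measurable \<nu>"
    using f_Lp g_Lq by (auto intro: Lp_space_measurable)
  have spec_le: "cmod z \<le> r" if "z \<in> spectrum \<nu> p ?T" for z
    unfolding r spectral_radius_def using that bdd_above_spectrum[OF fin] by (rule cSUP_upper)
  let ?f = "\<lambda>x. complex_of_real (f x)"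
  have fc: "?f \<in> Lp_space \<nu> p" using f_Lp by (simp add: Lp_space_of_real_iff)
  \<comment> \<open>Needed for 0 \<le> r, since \<open>SUP\<close> over an empty set of reals would
    be unspecified. Off the spectrum, the resolvent at r would send 0 both to f and to 0; as r is in
    the spectrum, 0 \<le> cmod r \<le> r.\<close>
  have "complex_of_real r \<in> spectrum \<nu> p ?T"
  proof (rule ccontr)
    assume *: "complex_of_real r \<notin> spectrum \<nu> p ?T"
    have zero: "(\<lambda>_. 0) \<in> Lp_space \<nu> p" by (rule Lp_norm_zero(1)[OF p]) auto
    have "AE x in \<nu>. r * ?f x - ?T ?f x = 0"
      using f_eigen by (auto simp: integral_op_of_real elim!: eventually_mono)
    from resolvent_unique[OF * fc zero this]
    have "AE x in \<nu>. resolvent (complex_of_real r) (\<lambda>_. 0) x = ?f x" .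
    moreover have "AE x in \<nu>. complex_of_real r * 0 - ?T (\<lambda>_. 0) x = 0" by (simp add: integral_op_def)
    from resolvent_unique[OF * zero zero this]
    have "AE x in \<nu>. resolvent (complex_of_real r) (\<lambda>_. 0) x = 0" .
    ultimately have "AE x in \<nu>. f x = 0" by eventually_elim simp
    then have "Lp_norm \<nu> p f = 0" by (intro Lp_norm_zero p) auto
    then show False using f_norm by simp
  qed
  then have r0: "0 \<le> r" using spec_le by (meson norm_ge_zero order_trans)

  define u where "u N = (?T ^^ N) (\<lambda>_. 1 :: real)" for N
  define A where "A N = (\<integral>x. u N x \<partial>\<mu>)" for N
  have u_Lp: "u N \<in> Lp_space \<nu> p" for N unfolding u_def using one_Lp by (rule real_funpow_closed)
  have [measurable]: "u N \<in> borel_measurable \<nu>" for N using u_Lp by (rule Lp_space_measurable)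
  have A_eq: "A N = (\<integral>x. g x * u N x \<partial>\<nu>)" for N
    unfolding A_def \<mu> using g_nonneg by (subst integral_density) auto
  obtain K where K: "0 \<le> K"
    and Hoelder: "\<And>h :: 'a \<Rightarrow> real. h \<in> Lp_space \<nu> p \<Longrightarrow>
      integrable \<nu> (\<lambda>x. g x *\<^sub>R h x) \<and> norm (\<integral>x. g x *\<^sub>R h x \<partial>\<nu>) \<le> K * Lp_norm \<nu> p h"
    using Lp_Hoelder[OF p q g_Lq] by blast
  \<comment> \<open>A second instance, at the complex type: it makes integration against g a
    functional on the space where the resolvent lives, while the real instance serves the order
    estimates.\<close>
  obtain K' where K': "0 \<le> K'"
    and Hoelder': "\<And>h :: 'a \<Rightarrow> complex. h \<in> Lp_space \<nu> p \<Longrightarrow>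
      integrable \<nu> (\<lambda>x. g x *\<^sub>R h x) \<and> norm (\<integral>x. g x *\<^sub>R h x \<partial>\<nu>) \<le> K' * Lp_norm \<nu> p h"
    using Lp_Hoelder[OF p q g_Lq] by blast

  have upper: "\<exists>B>0. \<forall>N. A N \<le> B * \<rho> ^ N" if \<rho>: "r < \<rho>" for \<rho>
  proof -
    define \<phi> where "\<phi> h = (\<integral>x. g x *\<^sub>R h x \<partial>\<nu>)" for h :: "'a \<Rightarrow> complex"
    have lin: "\<phi> (\<lambda>x. a * v x + b * w x) = a * \<phi> v + b * \<phi> w"
      if "v \<in> Lp_space \<nu> p" "w \<in> Lp_space \<nu> p" for a b v w
    proof -
      have "\<phi> (\<lambda>x. a * v x + b * w x) = (\<integral>x. a * (g x *\<^sub>R v x) + b * (g x *\<^sub>R w x) \<partial>\<nu>)"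
        unfolding \<phi>_def by (intro Bochner_Integration.integral_cong) (auto simp: scaleR_conv_of_real algebra_simps)
      also have "\<dots> = a * \<phi> v + b * \<phi> w"
        using Hoelder'[OF that(1)] Hoelder'[OF that(2)] by (simp add: \<phi>_def del: mult_scaleR_right)
      finally show ?thesis .
    qed
    have bd: "cmod (\<phi> v) \<le> K' * Lp_norm \<nu> p v" if "v \<in> Lp_space \<nu> p" for v
      using Hoelder' that by (simp add: \<phi>_def)
    have one: "(\<lambda>_. complex_of_real 1) \<in> Lp_space \<nu> p"
      using one_Lp by (rule Lp_space_of_real_iff[THEN iffD2])
    obtain B where B: "0 < B" "\<And>N. cmod (\<phi> ((?T ^^ N) (\<lambda>_. complex_of_real 1))) \<le> B * \<rho> ^ N"
      using functional_funpow_growth[OF lin bd K' fin r0 spec_le \<rho> one] by blast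
    have "\<phi> ((?T ^^ N) (\<lambda>_. complex_of_real 1)) = complex_of_real (A N)" for N
    proof -
      have "\<phi> ((?T ^^ N) (\<lambda>_. complex_of_real 1)) = (\<integral>x. complex_of_real (g x * u N x) \<partial>\<nu>)"
        unfolding \<phi>_def u_def funpow_of_real by (simp add: scaleR_conv_of_real)
      then show ?thesis by (simp only: A_eq integral_complex_of_real)
    qed
    then have "\<bar>A N\<bar> \<le> B * \<rho> ^ N" for N using B(2)[of N] by simp
    then have "A N \<le> B * \<rho> ^ N" for N using abs_le_D1 by blast
    then show ?thesis using B(1) by blast
  qed

  \<comment> \<open>A bound of f that is positive by construction, so f / b \<le> 1 almost
    everywhere and the iterates of 1 dominate those of f / b.\<close>
  define b where "b = Lp_norm \<nu> \<infinity> f + 1"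
  have b: "0 < b" using Lp_norm_nonneg[of \<nu> \<infinity> f] by (simp add: b_def)
  have f_le: "AE x in \<nu>. (1 / b) * f x \<le> 1"
  proof -
    have "AE x in \<nu>. norm (f x) \<le> b"
      using Lp_norm_le_iff[of \<infinity> f \<nu> b] f_bounded b by (simp add: b_def)
    then show ?thesis using b by (auto elim!: eventually_mono simp: field_simps)
  qed
  have gf_int: "integrable \<nu> (\<lambda>x. g x * f x)" using Hoelder[OF f_Lp] by simp
  have gf_nonneg: "AE x in \<nu>. 0 \<le> g x * f x"
    using g_nonneg f_pos by eventually_elim simp
  \<comment> \<open>As f > 0 almost everywhere, a vanishing integral of f against \<mu> would force
    g = 0 almost everywhere, i.e. \<mu> = 0.\<close>
  have gf_pos: "0 < (\<integral>x. g x * f x \<partial>\<nu>)"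
  proof -
    have "(\<integral>x. g x * f x \<partial>\<nu>) \<noteq> 0"
    proof
      assume "(\<integral>x. g x * f x \<partial>\<nu>) = 0"
      then have "AE x in \<nu>. g x * f x = 0"
        using integral_nonneg_eq_0_iff_AE[OF gf_int gf_nonneg] by simp
      then have "AE x in \<nu>. ennreal (g x) = 0" using f_pos by eventually_elim simp
      then have "(\<integral>\<^sup>+ x. ennreal (g x) \<partial>\<nu>) = 0" by (subst nn_integral_0_iff_AE) auto
      then have "emeasure \<mu> (space \<mu>) = 0"
        unfolding \<mu> by (subst emeasure_density) (auto simp: nn_integral_set_ennreal cong: nn_integral_cong)
      then show False using \<mu>_nonzero by simp
    qed
    then show ?thesis using integral_nonneg_AE[OF gf_nonneg] by simp
  qed
  \<comment> \<open>The integral of f / b with respect to \<mu>; the same constant serves the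
    general and the normal case.\<close>
  define c where "c = (1 / b) * (\<integral>x. g x * f x \<partial>\<nu>)"
  have c: "0 < c" using gf_pos b by (simp add: c_def)
  have lower: "c * r ^ N \<le> A N" for N
  proof -
    have "AE x in \<nu>. (1 / b) * r ^ N * f x \<le> u N x"
      unfolding u_def using f_Lp one_Lp r0 f_eigen f_le by (rule funpow_ge_eigenfunction)
    then have "AE x in \<nu>. (1 / b) * r ^ N * (g x * f x) \<le> g x * u N x"
      using g_nonneg
    proof eventually_elim
      case (elim x)
      then show ?case using mult_left_mono[OF elim(1), of "g x"] by (simp add: ac_simps)
    qed
    then have "(\<integral>x. (1 / b) * r ^ N * (g x * f x) \<partial>\<nu>) \<le> (\<integral>x. g x * u N x \<partial>\<nu>)"
      using gf_int Hoelder[OF u_Lp[of N]] by (intro integral_mono_AE) auto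
    then show ?thesis
      unfolding integral_mult_right_zero A_eq c_def by (simp add: mult_ac)
  qed

  have growth: "\<exists>e. e \<in> o(\<lambda>N. real N) \<and> (\<forall>N. ln (A N) = real N * ln r + e N)" if r_pos: "0 < r"
  proof (intro exI[of _ "\<lambda>N. ln (A N) - real N * ln r"] conjI allI)
    have A_pos: "0 < A N" for N using lower[of N] c r_pos by (intro less_le_trans[OF _ lower]) simp
    show "(\<lambda>N. ln (A N) - real N * ln r) \<in> o(\<lambda>N. real N)"
    proof (rule smallo_real_if_eventually_between[of "- ln c"])
      fix N
      have "ln (c * r ^ N) \<le> ln (A N)" using lower[of N] c r_pos by (intro ln_mono) auto
      then show "- (- ln c) \<le> ln (A N) - real N * ln r"
        using c r_pos by (simp add: ln_mult ln_realpow)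
    next
      fix \<epsilon> :: real assume \<epsilon>: "0 < \<epsilon>"
      \<comment> \<open>Writing the rate above r as r exp \<epsilon> makes the logarithm turn the
        slack into the slope \<epsilon>.\<close>
      have "r < r * exp \<epsilon>" using r_pos \<epsilon> by simp
      then obtain B where B: "0 < B" "\<And>N. A N \<le> B * (r * exp \<epsilon>) ^ N" using upper by blast
      have "ln (A N) - real N * ln r \<le> ln B + \<epsilon> * real N" for N
      proof -
        have "ln (A N) \<le> ln (B * (r * exp \<epsilon>) ^ N)" using A_pos[of N] B by (intro ln_mono) auto
        then show ?thesis using B(1) r_pos by (simp add: ln_mult ln_realpow algebra_simps)
      qed
      then show "\<exists>K. \<forall>N. ln (A N) - real N * ln r \<le> K + \<epsilon> * real N" by blast
    qed
  qed simp

  \<comment> \<open>For r = 0 the right-hand side is 0 whatever the error term, so the integrals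
    must vanish from N = 1 on.\<close>
  have vanish: "A N = 0" if "r = 0" "N \<ge> 1" for N
  proof -
    obtain m where m: "N = Suc m" using \<open>N \<ge> 1\<close> by (cases N) auto
    have "AE x in \<nu>. u N x = 0"
      using integral_op_zero[OF f_Lp f_pos] f_eigen \<open>r = 0\<close> by (simp add: u_def m)
    then have "AE x in \<nu>. g x * u N x = 0" by eventually_elim simp
    then show ?thesis unfolding A_eq by (rule integral_eq_zero_AE)
  qed

  have part1: "\<exists>e. e \<in> o(\<lambda>N. real N) \<and> (\<forall>N\<ge>1. A N = r powr (real N + e N))" if "r \<noteq> 1"
  proof (cases "r = 0")
    case True
    then show ?thesis using vanish by (intro exI[of _ "\<lambda>_. 0"]) auto
  next
    case False
    then have r_pos: "0 < r" using r0 by simp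
    \<comment> \<open>The exponential error is converted into an error of the exponent by dividing
      by ln r, which is why r = 1 stands apart.\<close>
    then have ln_r: "ln r \<noteq> 0" using \<open>r \<noteq> 1\<close> by simp
    obtain e where e: "e \<in> o(\<lambda>N. real N)" "\<And>N. ln (A N) = real N * ln r + e N"
      using growth[OF r_pos] by blast
    show ?thesis
    proof (intro exI[of _ "\<lambda>N. e N / ln r"] conjI allI impI)
      show "(\<lambda>N. e N / ln r) \<in> o(\<lambda>N. real N)" using e(1) ln_r by simp
      fix N :: nat
      have "0 < A N" using c r_pos by (intro less_le_trans[OF _ lower]) simp
      then have "A N = exp (real N * ln r + e N)" unfolding e(2)[symmetric] by (rule exp_ln[symmetric])
      also have "real N * ln r + e N = (real N + e N / ln r) * ln r" using ln_r by (simp add: field_simps)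
      finally show "A N = r powr (real N + e N / ln r)" using r_pos by (simp add: powr_def)
    qed
  qed
  have part2: "\<exists>e. e \<in> o(\<lambda>N. real N) \<and> (\<forall>N\<ge>1. A N = exp (e N))" if "r = 1"
  proof -
    obtain e where e: "e \<in> o(\<lambda>N. real N)" "\<And>N. ln (A N) = real N * ln r + e N"
      using growth \<open>r = 1\<close> by auto
    have "A N = exp (e N)" for N
    proof -
      have "0 < A N" using c \<open>r = 1\<close> by (intro less_le_trans[OF _ lower]) simp
      then show ?thesis using e(2)[of N] exp_ln[of "A N"] \<open>r = 1\<close> by simp
    qed
    then show ?thesis using e(1) by blast
  qed
  have part3: "\<exists>c>0. \<exists>C>0. \<forall>N. c * r ^ N \<le> A N \<and> A N \<le> C * r ^ N"
    if p2: "p = 2" and normal: "normal_operator \<nu> ?T"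
  proof -
    have fin2: "finite_measure \<nu>" using fin p2 by simp
    note adj = normal_transpose_eigenfunction[OF p2 fin2 normal r0 f_Lp f_pos f_eigen]
    \<comment> \<open>The Hoelder constant of g times the norm of 1; the summand 1 only keeps C
      positive.\<close>
    define C where "C = K * Lp_norm \<nu> p (\<lambda>_. 1 :: real) + 1"
    have C: "0 < C" using K Lp_norm_nonneg[of \<nu> p "\<lambda>_. 1 :: real"] by (auto simp: C_def intro: add_nonneg_pos)
    have "A N \<le> C * r ^ N" for N
    proof -
      have one: "(\<lambda>_. complex_of_real 1) \<in> Lp_space \<nu> p"
        using one_Lp by (rule Lp_space_of_real_iff[THEN iffD2])
      \<comment> \<open>One application of the operator costs exactly the factor r by the Schur
        test, so iteration incurs no subexponential loss.\<close>
      have "Lp_norm \<nu> p ((?T ^^ N) (\<lambda>_. complex_of_real 1)) \<le> r ^ N * Lp_norm \<nu> p (\<lambda>_. complex_of_real 1)"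
        by (rule funpow_bound[OF r0 Schur_test[OF p2 r0 f_Lp f_pos f_eigen adj] one])
      then have u_le: "Lp_norm \<nu> p (u N) \<le> r ^ N * Lp_norm \<nu> p (\<lambda>_. 1 :: real)"
        unfolding funpow_of_real Lp_norm_of_real u_def .
      have "A N \<le> K * Lp_norm \<nu> p (u N)" using Hoelder[OF u_Lp[of N]] by (simp add: A_eq abs_le_iff)
      also have "\<dots> \<le> K * (r ^ N * Lp_norm \<nu> p (\<lambda>_. 1 :: real))" using u_le K by (rule mult_left_mono)
      also have "\<dots> \<le> C * r ^ N" using r0 by (simp add: C_def algebra_simps)
      finally show ?thesis .
    qed
    then show ?thesis using c C lower by blast
  qed
  show ?thesis
    using part1 part2 part3 unfolding A_def u_def by blast
qed

end
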